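(* Let $\gamma$ be a POMM on a countable color space $E$. If the Bernoulli distribution $\psi_{\mathbf p^\gamma}$ does not percolate, then $\gamma$ has at most one consistent chain, i.e. $|\mathcal G(\gamma)|\le1$.
   Context: $(S,\le)$ is a countable partially ordered set. For $x\in S$ write $x_-=\{y\in S:y<x\}$, $x_+=\{y\in S:y>x\}$. For $\Upsilon\subset S$: $\max(\Upsilon)=\{x\in\Upsilon: y\notin\Upsilon\text{ for all }y>x\}$, $\min(\Upsilon)=\{x\in\Upsilon: y\notin\Upsilon\text{ for all }y<x\}$, the past $\Upsilon_-=\{x\in S\setminus\Upsilon:\exists y\in\Upsilon,\ x<y\}$, the future $\Upsilon_+=\{x\in S\setminus\Upsilon:\exists y\in\Upsilon,\ x>y\}$, and the outer time $\Upsilon^*=\{x\in S: x\text{ is comparable with no }y\in\Upsilon\}$. Standing assumptions: for every $x\in S$, $\max(x_-)$ and $\min(x_+)$ are finite, every $y<x$ satisfies $y\le y_0<x$ for some $y_0\in\max(x_-)$, every $z>x$ satisfies $z\ge z_0>x$ for some $z_0\in\min(x_+)$; and $S$ has no minimal element. A finite set $\Lambda\subset S$ is a time box if $\Lambda_-\cap\Lambda_+=\emptyset$. $\Omega=E^S$ with product $\sigma$-algebra $\mathcal F$; $\mathcal F_\Upsilon$ is generated by coordinates in $\Upsilon$. A proper oriented kernel on a time box $\Lambda$ is a map $\gamma_\Lambda:\mathcal F_{S\setminus\Lambda_+}\times\Omega\to[0,1]$ such that (a) $\gamma_\Lambda(\cdot,\omega)$ is a probability measure; (b) $\gamma_\Lambda(A,\cdot)$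 is $\mathcal F_{\Lambda_-\cup\Lambda^*}$-measurable for $A\in\mathcal F_{S\setminus\Lambda_+}$; (c) $\gamma_\Lambda(A,\cdot)$ is $\mathcal F_{\Lambda_-}$-measurable for $A\in\mathcal F_\Lambda$; (d) $\gamma_\Lambda(B,\omega)=\mathbf 1_B(\omega)$ for $B\in\mathcal F_{\Lambda_-\cup\Lambda^*}$. Compositions $(\gamma_\Delta\gamma_\Lambda)(f\mid\omega)=\int\gamma_\Lambda(f\mid\sigma)\gamma_\Delta(d\sigma,\omega)$, $(\mu\gamma_\Lambda)(f)=\int\gamma_\Lambda(f\mid\sigma)\mu(d\sigma)$. A POS is a family $\gamma=(\gamma_\Lambda)$ of proper oriented kernels indexed by all time boxes with $\gamma_\Delta\gamma_\Lambda=\gamma_\Delta$ on $\mathcal F_{S\setminus\Lambda_+}$ whenever $\Lambda\subset\Delta$; $\gamma_x=\gamma_{\{x\}}$ and $\gamma_x(a\mid\omega)=\gamma_x(\{\sigma:\sigma_x=a\},\omega)$. $\mathcal G(\gamma)$ is the set of probability measures $\mu$ with $\mu\gamma_\Lambda=\mu$ on $\mathcal F_{S\setminus\Lambda_+}$ for all time boxes. Nearest past: $\underline\partial x=\max(x_-)$ and $\underline\partial\Lambda=(\bigcup_{x\in\Lambda}\underline\partial x)\setminus\Lambda$. A POMM is a POS such that for every time box $\Lambda$ and every $A\in\mathcal F_\Lambda$, $\gamma_\Lambda(A\mid\cdot)$ is $\mathcal F_{\underline\partial\Lambda}$-measurable. Its maximal percolation parameters are $p^\gamma_x=\sup_{\eta,\xi\in\Omega}\frac12\sum_{a\in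 E}|\gamma_x(a\mid\eta)-\gamma_x(a\mid\xi)|$, $\mathbf p^\gamma=(p^\gamma_x)_{x\in S}$. For $\mathbf p=(p_x)\in[0,1]^S$, $\psi_{\mathbf p}$ is the product Bernoulli measure on $\{0,1\}^S$ with $\psi_{\mathbf p}(X_x=1)=p_x$; site $x$ is open if $X_x=1$. For $y<x$, $(x\rightsquigarrow y)$ is the event that there exist $x_1=x,x_2,\dots,x_n=y$ with $x_{k+1}\in\underline\partial x_k$ for all $k$ and $X_{x_k}=1$ for all $k$; $(x\rightsquigarrow-\infty)$ is the event that there is an infinite strictly decreasing sequence $(y_n)$ with $(x\rightsquigarrow y_n)$ for all $n$. $\psi_{\mathbf p}$ does not percolate if $\psi_{\mathbf p}(x\rightsquigarrow-\infty)=0$ for every $x\in S$. *)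

theory Defs
  imports "HOL-Probability.Probability"
begin

definition pos_max :: "'a::order set \<Rightarrow> 'a set" where
  "pos_max U = {x \<in> U. \<forall>y. x < y \<longrightarrow> y \<notin> U}"

definition pos_min :: "'a::order set \<Rightarrow> 'a set" where
  "pos_min U = {x \<in> U. \<forall>y. y < x \<longrightarrow> y \<notin> U}"

definition pos_past :: "'a::order set \<Rightarrow> 'a set" where
  "pos_past U = {x. x \<notin> U \<and> (\<exists>y\<in>U. x < y)}"

definition pos_future :: "'a::order set \<Rightarrow> 'a set" where
  "pos_future U = {x. x \<notin> U \<and> (\<exists>y\<in>U. y < x)}"

definition pos_outer :: "'a::order set \<Rightarrow> 'a set" where
  "pos_outer U = {x. \<forall>y\<in>U. \<not> (x \<le> y) \<and> \<not> (y \<le> x)}"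

definition time_box :: "'a::order set \<Rightarrow> bool" where
  "time_box L \<longleftrightarrow> finite L \<and> pos_past L \<inter> pos_future L = {}"

definition near_past_pt :: "'a::order \<Rightarrow> 'a set" where
  "near_past_pt x = pos_max {y. y < x}"

definition near_past :: "'a::order set \<Rightarrow> 'a set" where
  "near_past L = (\<Union>x\<in>L. near_past_pt x) - L"

text \<open>\<open>coord_sets U\<close> is the sigma-algebra on \<open>\<Omega> = E^S\<close> generated by the coordinates in U
  (E carries the discrete sigma-algebra).\<close>
definition coord_sets :: "'a set \<Rightarrow> ('a \<Rightarrow> 'e) set set" where
  "coord_sets U = sigma_sets UNIV {{\<omega>. \<omega> x \<in> B} | x B. x \<in> U}"

definition meas_wrt :: "'a set \<Rightarrow> (('a \<Rightarrow> 'e) \<Rightarrow> real) \<Rightarrow> bool" where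
  "meas_wrt U f \<longleftrightarrow> (\<forall>B\<in>sets borel. f -` B \<in> coord_sets U)"

text \<open>A kernel on a time box L is represented by \<open>g :: \<Omega> \<Rightarrow> \<Omega> set \<Rightarrow> real\<close>, where
  \<open>g \<omega> A\<close> stands for \<open>\<gamma>_L(A, \<omega>)\<close>; only its values on \<open>coord_sets (- pos_future L)\<close> matter.\<close>
definition kernel_measure :: "('a::order set) \<Rightarrow> (('a \<Rightarrow> 'e) \<Rightarrow> ('a \<Rightarrow> 'e) set \<Rightarrow> real)
    \<Rightarrow> ('a \<Rightarrow> 'e) \<Rightarrow> ('a \<Rightarrow> 'e) measure" where
  "kernel_measure L g \<omega> = measure_of UNIV (coord_sets (- pos_future L)) (\<lambda>A. ennreal (g \<omega> A))"

definition proper_oriented_kernel ::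
    "'a::order set \<Rightarrow> (('a \<Rightarrow> 'e) \<Rightarrow> ('a \<Rightarrow> 'e) set \<Rightarrow> real) \<Rightarrow> bool" where
  "proper_oriented_kernel L g \<longleftrightarrow>
     (\<forall>\<omega>. measure_space UNIV (coord_sets (- pos_future L)) (\<lambda>A. ennreal (g \<omega> A))
          \<and> (\<forall>A\<in>coord_sets (- pos_future L). 0 \<le> g \<omega> A)
          \<and> g \<omega> UNIV = 1)
   \<and> (\<forall>A\<in>coord_sets (- pos_future L). meas_wrt (pos_past L \<union> pos_outer L) (\<lambda>\<omega>. g \<omega> A))
   \<and> (\<forall>A\<in>coord_sets L. meas_wrt (pos_past L) (\<lambda>\<omega>. g \<omega> A))
   \<and> (\<forall>B\<in>coord_sets (pos_past L \<union> pos_outer L). \<forall>\<omega>. g \<omega> B = indicator B \<omega>)"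

definition POS :: "('a::order set \<Rightarrow> ('a \<Rightarrow> 'e) \<Rightarrow> ('a \<Rightarrow> 'e) set \<Rightarrow> real) \<Rightarrow> bool" where
  "POS \<gamma> \<longleftrightarrow>
     (\<forall>L. time_box L \<longrightarrow> proper_oriented_kernel L (\<gamma> L))
   \<and> (\<forall>L D. time_box L \<and> time_box D \<and> L \<subseteq> D \<longrightarrow>
        (\<forall>\<omega>. \<forall>A\<in>coord_sets (- pos_future L) \<inter> coord_sets (- pos_future D).
            (\<integral>\<sigma>. \<gamma> L \<sigma> A \<partial>kernel_measure D (\<gamma> D) \<omega>) = \<gamma> D \<omega> A))"

definition POMM :: "('a::order set \<Rightarrow> ('a \<Rightarrow> 'e) \<Rightarrow> ('a \<Rightarrow> 'e) set \<Rightarrow> real) \<Rightarrow> bool" where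
  "POMM \<gamma> \<longleftrightarrow> POS \<gamma> \<and>
     (\<forall>L. time_box L \<longrightarrow> (\<forall>A\<in>coord_sets L. meas_wrt (near_past L) (\<lambda>\<omega>. \<gamma> L \<omega> A)))"

definition consistent_chains ::
    "('a::order set \<Rightarrow> ('a \<Rightarrow> 'e) \<Rightarrow> ('a \<Rightarrow> 'e) set \<Rightarrow> real) \<Rightarrow> ('a \<Rightarrow> 'e) measure set" where
  "consistent_chains \<gamma> = {\<mu>. prob_space \<mu> \<and> space \<mu> = UNIV \<and> sets \<mu> = coord_sets UNIV \<and>
      (\<forall>L. time_box L \<longrightarrow>
         (\<forall>A\<in>coord_sets (- pos_future L). (\<integral>\<sigma>. \<gamma> L \<sigma> A \<partial>\<mu>) = measure \<mu> A))}"

definition single_site :: "('a::order set \<Rightarrow> ('a \<Rightarrow> 'e) \<Rightarrow> ('a \<Rightarrow> 'e) set \<Rightarrow> real)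
    \<Rightarrow> 'a \<Rightarrow> 'e \<Rightarrow> ('a \<Rightarrow> 'e) \<Rightarrow> real" where
  "single_site \<gamma> x a \<omega> = \<gamma> {x} \<omega> {\<sigma>. \<sigma> x = a}"

definition perc_param :: "('a::order set \<Rightarrow> ('a \<Rightarrow> 'e) \<Rightarrow> ('a \<Rightarrow> 'e) set \<Rightarrow> real) \<Rightarrow> 'a \<Rightarrow> real" where
  "perc_param \<gamma> x = (SUP \<eta>. SUP \<xi>.
      (1/2) * (\<Sum>\<^sub>\<infinity> a. \<bar>single_site \<gamma> x a \<eta> - single_site \<gamma> x a \<xi>\<bar>))"

text \<open>Product Bernoulli measure on \<open>{0,1}^S\<close>; site x is open iff \<open>X x = True\<close>.\<close>
definition bernoulli_field :: "('a \<Rightarrow> real) \<Rightarrow> ('a \<Rightarrow> bool) measure" where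
  "bernoulli_field p = (\<Pi>\<^sub>M x\<in>UNIV. measure_pmf (bernoulli_pmf (p x)))"

definition open_path :: "('a::order \<Rightarrow> bool) \<Rightarrow> 'a \<Rightarrow> 'a \<Rightarrow> bool" where
  "open_path X x y \<longleftrightarrow> y < x \<and>
     (\<exists>xs. xs \<noteq> [] \<and> hd xs = x \<and> last xs = y
        \<and> (\<forall>k. Suc k < length xs \<longrightarrow> xs ! Suc k \<in> near_past_pt (xs ! k))
        \<and> (\<forall>z\<in>set xs. X z))"

definition percolates_from :: "('a::order \<Rightarrow> bool) \<Rightarrow> 'a \<Rightarrow> bool" where
  "percolates_from X x \<longleftrightarrow>
     (\<exists>ys :: nat \<Rightarrow> 'a. (\<forall>n. ys (Suc n) < ys n) \<and> (\<forall>n. open_path X x (ys n)))"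

definition non_percolating :: "('a::order \<Rightarrow> real) \<Rightarrow> bool" where
  "non_percolating p \<longleftrightarrow> (\<forall>x. AE X in bernoulli_field p. \<not> percolates_from X x)"

end

theory Submission
  imports Defs
begin

text \<open>
  Disagreement percolation, using single-site kernels only. Let \<open>A\<close> depend on a finite set \<open>V\<close> of
  sites, and list the sites that are reachable from \<open>V\<close> by fewer than \<open>n\<close> nearest-past steps, maximal
  ones first. Integrating out these sites one after the other, and replacing the dependence on
  sites outside the list by a supremum, gives a constant \<open>u(A)\<close> with \<open>\<mu>(A) \<le> u(A)\<close> for every consistent
  chain \<open>\<mu>\<close>. Under the maximal coupling, two configurations differ at \<open>x\<close> with probability at most
  \<open>p x\<close>, and only if they already differ in the nearest past of \<open>x\<close>. Hence \<open>u(A) + u(-A)\<close> exceeds \<open>1\<close> by at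
  most the Bernoulli probability that an open path with \<open>n\<close> sites starts in \<open>V\<close>. By Koenig's lemma
  this probability tends to \<open>0\<close> in the absence of percolation, so that
  \<open>\<mu>(A) + \<nu>(-A) \<le> 1\<close> for all consistent chains \<open>\<mu>\<close> and \<open>\<nu>\<close>.
\<close>

subsection \<open>Functions of finitely many coordinates\<close>

text \<open>Dependence on coordinates with no measurability built in. For finite \<open>U\<close>
  and countably many colours it amounts to measurability with respect to
  \<open>coord_sets U\<close>, and it survives suprema over arbitrarily many configurations.\<close>

definition depends_on :: "'a set \<Rightarrow> (('a \<Rightarrow> 'b) \<Rightarrow> 'c) \<Rightarrow> bool" where
  "depends_on U f \<longleftrightarrow> (\<forall>\<omega> \<omega>'. (\<forall>u\<in>U. \<omega> u = \<omega>' u) \<longrightarrow> f \<omega> = f \<omega>')"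

lemma depends_onI:
  assumes "\<And>\<omega> \<omega>'. (\<And>u. u \<in> U \<Longrightarrow> \<omega> u = \<omega>' u) \<Longrightarrow> f \<omega> = f \<omega>'"
  shows "depends_on U f"
  unfolding depends_on_def by (intro allI impI assms) simp

lemma depends_onD:
  assumes "depends_on U f" "\<And>u. u \<in> U \<Longrightarrow> \<omega> u = \<omega>' u"
  shows "f \<omega> = f \<omega>'"
  using assms unfolding depends_on_def by blast

lemma sigma_algebra_coord_sets: "sigma_algebra UNIV (coord_sets U)"
  unfolding coord_sets_def by (rule sigma_algebra_sigma_sets) auto

lemma coord_sets_mono: "U \<subseteq> V \<Longrightarrow> coord_sets U \<subseteq> coord_sets V"
  unfolding coord_sets_def by (rule sigma_sets_mono') blast

lemma coord_sets_coordinate: "x \<in> U \<Longrightarrow> {\<omega>. \<omega> x \<in> B} \<in> coord_sets U"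
  unfolding coord_sets_def by (rule sigma_sets.Basic) blast

lemma coord_sets_eq_sets_PiM:
  "coord_sets UNIV = sets (PiM UNIV (\<lambda>x. count_space UNIV))"
  unfolding coord_sets_def sets_PiM_single by (simp add: PiE_def Pi_def extensional_def)

lemma coord_sets_imp_depends_on:
  assumes "A \<in> coord_sets U"
  shows "depends_on U (\<lambda>\<omega>. \<omega> \<in> A)"
  using assms unfolding coord_sets_def
proof (induction rule: sigma_sets.induct)
  case (Basic a)
  then show ?case by (auto simp: depends_on_def)
next
  case Empty
  then show ?case by (auto simp: depends_on_def)
next
  case (Compl a)
  then show ?case by (auto simp: depends_on_def)
next
  case (Union a)
  then show ?case unfolding depends_on_def by blast
qed

text \<open>The level set of \<open>f\<close> through \<open>\<omega>\<close> lies in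
  \<open>coord_sets U\<close>, so a change outside \<open>U\<close> cannot leave it.\<close>

lemma meas_wrt_imp_depends_on:
  assumes "meas_wrt U f"
  shows "depends_on U f"
proof (rule depends_onI)
  fix \<omega> \<omega>' :: "'a \<Rightarrow> 'b"
  assume *: "\<And>u. u \<in> U \<Longrightarrow> \<omega> u = \<omega>' u"
  have "f -` {f \<omega>} \<in> coord_sets U"
    using assms by (simp add: meas_wrt_def)
  from depends_onD[OF coord_sets_imp_depends_on[OF this], of \<omega> \<omega>'] *
  show "f \<omega> = f \<omega>'" by simp
qed

text \<open>With finitely many sites and countably many colours there are only countably many
  patterns on \<open>U\<close>, and \<open>A\<close> is the union of the cylinders over the patterns
  that it contains.\<close>

lemma depends_on_imp_coord_sets:
  fixes A :: "('a \<Rightarrow> 'e::countable) set"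
  assumes "finite U" and dep: "depends_on U (\<lambda>\<omega>. \<omega> \<in> A)"
  shows "A \<in> coord_sets U"
proof -
  interpret sigma_algebra UNIV "coord_sets U :: ('a \<Rightarrow> 'e) set set"
    by (rule sigma_algebra_coord_sets)
  define C where "C s = {\<omega>. \<forall>u\<in>U. \<omega> u = s u}" for s :: "'a \<Rightarrow> 'e"
  have C: "C s \<in> coord_sets U" for s
  proof (cases "U = {}")
    case True
    then show ?thesis using top by (simp add: C_def)
  next
    case False
    have "C s = (\<Inter>u\<in>U. {\<omega>. \<omega> u \<in> {s u}})"
      by (auto simp: C_def)
    also have "\<dots> \<in> coord_sets U"
      using \<open>finite U\<close> False by (intro finite_INT coord_sets_coordinate)
    finally show ?thesis .
  qed
  \<comment> \<open>Each pattern on \<open>U\<close> is represented once, by its extension that is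
    \<open>undefined\<close> off \<open>U\<close>; this keeps the index set countable.\<close>
  define I where "I = PiE U (\<lambda>_. UNIV :: 'e set)"
  have "countable I"
    unfolding I_def by (intro countable_PiE assms) auto
  moreover have "A = (\<Union>s\<in>A \<inter> I. C s)"
  proof (intro equalityI subsetI)
    fix \<omega> assume "\<omega> \<in> A"
    moreover have "\<omega> \<in> A \<longleftrightarrow> restrict \<omega> U \<in> A"
      by (rule depends_onD[OF dep]) simp
    ultimately show "\<omega> \<in> (\<Union>s\<in>A \<inter> I. C s)"
      by (intro UN_I[of "restrict \<omega> U"]) (auto simp: I_def C_def)
  next
    fix \<omega> assume "\<omega> \<in> (\<Union>s\<in>A \<inter> I. C s)"
    then obtain s where "s \<in> A" "\<omega> \<in> C s" by blast
    moreover from this have "\<omega> \<in> A \<longleftrightarrow> s \<in> A"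
      by (intro depends_onD[OF dep]) (simp add: C_def)
    ultimately show "\<omega> \<in> A" by simp
  qed
  ultimately show ?thesis
    using C countable_UN''[of "A \<inter> I" C] by (metis countable_Int2)
qed

lemma depends_on_imp_measurable:
  fixes f :: "('a \<Rightarrow> 'e::countable) \<Rightarrow> 'c"
  assumes "finite U" "depends_on U f" "U \<subseteq> V" "sets M = coord_sets V" "space N = UNIV"
  shows "f \<in> measurable M N"
proof (rule measurableI)
  have sp: "space M = UNIV"
    using sets_eq_imp_space_eq[of M "sigma UNIV (coord_sets V)"] assms(4) sigma_algebra_coord_sets[of V]
    by (metis sets.sigma_algebra_axioms sigma_algebra.axioms(1) sigma_algebra.sets_measure_of_eq
        space_measure_of_conv)
  fix A
  have "f -` A \<in> coord_sets U"
    using assms(1,2)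
    by (intro depends_on_imp_coord_sets) (auto simp: depends_on_def, metis+)
  then show "f -` A \<inter> space M \<in> sets M"
    using coord_sets_mono[OF assms(3)] assms(4) sp by auto
qed (use assms in simp)

text \<open>A maximal element is put in front of a list of the others. Since no site then lies below
  a later one, the kernel of the head can be applied to a function of the whole list.\<close>

lemma finite_list_maximal_first:
  fixes W :: "'a::order set"
  assumes "finite W"
  shows "\<exists>ws. set ws = W \<and> distinct ws \<and> sorted_wrt (\<lambda>a b. \<not> a < b) ws"
  using assms
proof (induction "card W" arbitrary: W)
  case 0
  then show ?case by auto
next
  case (Suc n)
  then have "W \<noteq> {}" by auto
  from finite_has_maximal[OF \<open>finite W\<close> this]
  obtain m where m: "m \<in> W" "\<forall>y\<in>W. m \<le> y \<longrightarrow> m = y" by blast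
  have "n = card (W - {m})" using Suc m by simp
  from Suc.hyps(1)[OF this] Suc.prems obtain ws
    where ws: "set ws = W - {m}" "distinct ws" "sorted_wrt (\<lambda>a b. \<not> a < b) ws" by auto
  have "set (m # ws) = W \<and> distinct (m # ws) \<and> sorted_wrt (\<lambda>a b. \<not> a < b) (m # ws)"
    using ws m by (auto simp: less_le)
  then show ?case by blast
qed

subsection \<open>Maximal coupling\<close>

lemma integral_pmf_UNIV: "integral\<^sup>L (count_space UNIV) (pmf P) = 1"
  by (simp add: integral_pmf)

lemma infsum_abs_pmf_diff:
  "(\<Sum>\<^sub>\<infinity>a. \<bar>pmf P a - pmf Q a\<bar>) = (\<integral>a. \<bar>pmf P a - pmf Q a\<bar> \<partial>count_space UNIV)"
  by (subst infsetsum_infsum[symmetric])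
     (auto simp: infsetsum_def abs_summable_on_def intro!: integrable_pmf)

text \<open>This is the bound given by the maximal coupling of \<open>P\<close> and \<open>Q\<close>, read off from the common
  part \<open>min P Q\<close> without constructing the coupling.\<close>

lemma pmf_integral_add_le_coupling:
  fixes P Q :: "'e pmf" and u v :: "'e \<Rightarrow> real"
  assumes u: "\<And>a. 0 \<le> u a" "\<And>a. u a \<le> 1" and v: "\<And>a. 0 \<le> v a" "\<And>a. v a \<le> 1"
    and off: "\<And>a b. u a + v b \<le> 1 + \<alpha>" and diag: "\<And>a. u a + v a \<le> 1 + \<beta>"
    and "\<beta> \<le> \<alpha>"
    and tv: "(1/2) * (\<Sum>\<^sub>\<infinity>a. \<bar>pmf P a - pmf Q a\<bar>) \<le> p"
  shows "(\<integral>a. u a \<partial>P) + (\<integral>a. v a \<partial>Q) \<le> 1 + p * \<alpha> + (1 - p) * \<beta>"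
proof -
  let ?C = "count_space (UNIV :: 'e set)"
  define m where "m a = min (pmf P a) (pmf Q a)" for a
  define M where "M = integral\<^sup>L ?C m"
  define s where "s = (SUP a. u a)"
  define t where "t = (SUP a. v a)"
  note intP = integrable_pmf integral_pmf_UNIV
  have intm: "integrable ?C m"
    by (rule Bochner_Integration.integrable_bound[OF integrable_pmf[of _ P]]) (auto simp: m_def)
  have bnd: "integrable ?C (\<lambda>a. r a * w a)"
    if "integrable ?C r" "\<And>a. 0 \<le> w a" "\<And>a. w a \<le> 1" for r w :: "'e \<Rightarrow> real"
    by (rule Bochner_Integration.integrable_bound[OF that(1)])
       (use that in \<open>auto simp: abs_mult intro!: mult_left_le\<close>)
  have us: "u a \<le> s" for a unfolding s_def by (rule cSUP_upper) (auto intro: bdd_aboveI2[of _ _ 1] u)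
  have vt: "v a \<le> t" for a unfolding t_def by (rule cSUP_upper) (auto intro: bdd_aboveI2[of _ _ 1] v)
  \<comment> \<open>The two arguments in \<open>off\<close> vary independently, so both suprema may
    be taken and \<open>s + t\<close> inherits the bound.\<close>
  have "s \<le> 1 + \<alpha> - v b" for b
    unfolding s_def by (rule cSUP_least) (use off[of _ b] in \<open>auto simp: algebra_simps\<close>)
  then have "v b \<le> 1 + \<alpha> - s" for b by (smt (verit))
  then have "t \<le> 1 + \<alpha> - s"
    unfolding t_def by (intro cSUP_least) auto
  then have st: "s + t \<le> 1 + \<alpha>" by simp
  \<comment> \<open>On the common part \<open>m\<close> the function is kept; the remaining mass
    \<open>1 - M\<close> of \<open>R\<close> is charged with the upper bound
    \<open>c\<close>.\<close>
  have split: "(\<integral>a. w a \<partial>R) \<le> (\<integral>a. m a * w a \<partial>?C) + (1 - M) * c"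
    if "\<And>a. 0 \<le> w a" "\<And>a. w a \<le> 1" "\<And>a. w a \<le> c" "\<And>a. m a \<le> pmf R a" for w R c
  proof -
    have "(\<integral>a. w a \<partial>R) = (\<integral>a. pmf R a * w a \<partial>?C)"
      by (simp add: measure_pmf_eq_density integral_real_density)
    also have "\<dots> \<le> (\<integral>a. m a * w a + (pmf R a - m a) * c \<partial>?C)"
    proof (rule integral_mono)
      show "integrable ?C (\<lambda>a. pmf R a * w a)"
        by (rule bnd[OF integrable_pmf]) (use that in auto)
      show "integrable ?C (\<lambda>a. m a * w a + (pmf R a - m a) * c)"
        by (intro Bochner_Integration.integrable_add bnd integrable_mult_left
              Bochner_Integration.integrable_diff intm intP) (use that in auto)
      fix a
      have "(pmf R a - m a) * w a \<le> (pmf R a - m a) * c"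
        using that by (intro mult_left_mono) auto
      then show "pmf R a * w a \<le> m a * w a + (pmf R a - m a) * c"
        by (simp add: algebra_simps)
    qed
    also have "\<dots> = (\<integral>a. m a * w a \<partial>?C) + (1 - M) * c"
      by (subst Bochner_Integration.integral_add)
         (use that in \<open>auto intro!: bnd intm intP simp: intP intm M_def\<close>)
    finally show ?thesis .
  qed
  \<comment> \<open>As |a - b| = a + b - 2 min(a, b), the total variation distance of
    \<open>P\<close> and \<open>Q\<close> is exactly \<open>1 - M\<close>.\<close>
  have "integral\<^sup>L ?C (\<lambda>a. \<bar>pmf P a - pmf Q a\<bar>) = integral\<^sup>L ?C (\<lambda>a. pmf P a + pmf Q a - 2 * m a)"
    by (rule Bochner_Integration.integral_cong) (auto simp: m_def)
  also have "\<dots> = 2 * (1 - M)"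
    using intm by (simp add: M_def integral_pmf_UNIV integrable_pmf Bochner_Integration.integral_diff)
  finally have "integral\<^sup>L ?C (\<lambda>a. \<bar>pmf P a - pmf Q a\<bar>) = 2 * (1 - M)" .
  moreover have "(\<Sum>\<^sub>\<infinity>a. \<bar>pmf P a - pmf Q a\<bar>) = integral\<^sup>L ?C (\<lambda>a. \<bar>pmf P a - pmf Q a\<bar>)"
    by (rule infsum_abs_pmf_diff)
  ultimately have Mp: "1 - M \<le> p" using tv by simp
  have "0 \<le> 1 - M"
    using integral_mono[OF intm integrable_pmf[of _ P]] integral_pmf_UNIV[of P] by (simp add: M_def m_def)
  have "(\<integral>a. m a * u a \<partial>?C) + (\<integral>a. m a * v a \<partial>?C) = (\<integral>a. m a * u a + m a * v a \<partial>?C)"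
    using u v intm by (intro Bochner_Integration.integral_add[symmetric] bnd) auto
  also have "\<dots> \<le> (\<integral>a. m a * (1 + \<beta>) \<partial>?C)"
  proof (rule integral_mono)
    show "integrable ?C (\<lambda>a. m a * u a + m a * v a)"
      using u v intm by (intro Bochner_Integration.integrable_add bnd) auto
    show "m a * u a + m a * v a \<le> m a * (1 + \<beta>)" for a
      using mult_left_mono[OF diag[of a], of "m a"] by (simp add: m_def algebra_simps)
  qed (use intm in simp)
  also have "\<dots> = M * (1 + \<beta>)" by (simp add: M_def)
  finally have "(\<integral>a. u a \<partial>P) + (\<integral>a. v a \<partial>Q) \<le> M * (1 + \<beta>) + (1 - M) * (s + t)"
    using split[of u s P] split[of v t Q] u v us vt by (simp add: m_def algebra_simps)
  also have "\<dots> \<le> M * (1 + \<beta>) + (1 - M) * (1 + \<alpha>)"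
    using st \<open>0 \<le> 1 - M\<close> by (intro add_left_mono mult_left_mono) auto
  also have "\<dots> = 1 + \<beta> + (1 - M) * (\<alpha> - \<beta>)" by (simp add: algebra_simps)
  \<comment> \<open>Because \<open>\<beta> \<le> \<alpha>\<close>, the bound grows with the
    uncoupled mass, which may be replaced by \<open>p\<close>.\<close>
  also have "\<dots> \<le> 1 + \<beta> + p * (\<alpha> - \<beta>)"
    using Mp \<open>\<beta> \<le> \<alpha>\<close> by (intro add_left_mono mult_right_mono) auto
  finally show ?thesis by (simp add: algebra_simps)
qed

lemma half_infsum_abs_pmf_diff_bounds:
  fixes P Q :: "'e pmf"
  shows "0 \<le> (1/2) * (\<Sum>\<^sub>\<infinity>a. \<bar>pmf P a - pmf Q a\<bar>)"
    and "(1/2) * (\<Sum>\<^sub>\<infinity>a. \<bar>pmf P a - pmf Q a\<bar>) \<le> 1"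
proof -
  let ?C = "count_space (UNIV :: 'e set)"
  have "(\<Sum>\<^sub>\<infinity>a. \<bar>pmf P a - pmf Q a\<bar>) = integral\<^sup>L ?C (\<lambda>a. \<bar>pmf P a - pmf Q a\<bar>)"
    by (rule infsum_abs_pmf_diff)
  also have "\<dots> \<le> integral\<^sup>L ?C (\<lambda>a. pmf P a + pmf Q a)"
    by (rule integral_mono)
       (auto simp: abs_le_iff intro!: integrable_abs Bochner_Integration.integrable_diff
          Bochner_Integration.integrable_add integrable_pmf)
  also have "\<dots> = 2" by (simp add: integral_pmf_UNIV integrable_pmf)
  finally show "(1/2) * (\<Sum>\<^sub>\<infinity>a. \<bar>pmf P a - pmf Q a\<bar>) \<le> 1" by simp
  show "0 \<le> (1/2) * (\<Sum>\<^sub>\<infinity>a. \<bar>pmf P a - pmf Q a\<bar>)"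
    by (simp add: infsum_nonneg)
qed

subsection \<open>Single-site kernels\<close>

lemma pos_future_singleton: "pos_future {x} = {y. x < y}"
  by (auto simp: pos_future_def)

lemma time_box_singleton: "time_box {x}"
  by (auto simp: time_box_def pos_past_def pos_future_def)

lemma near_past_singleton: "near_past {x} = near_past_pt x"
  by (auto simp: near_past_def near_past_pt_def pos_max_def)

lemma near_past_pt_less: "y \<in> near_past_pt x \<Longrightarrow> y < x"
  by (simp add: near_past_pt_def pos_max_def)

lemma sets_kernel_measure [simp]: "sets (kernel_measure L g \<omega>) = coord_sets (- pos_future L)"
  by (simp add: kernel_measure_def sigma_algebra.sets_measure_of_eq[OF sigma_algebra_coord_sets])

lemma space_kernel_measure [simp]: "space (kernel_measure L g \<omega>) = UNIV"
  by (simp add: kernel_measure_def)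

lemma emeasure_kernel_measure:
  assumes "proper_oriented_kernel L g" "A \<in> coord_sets (- pos_future L)"
  shows "emeasure (kernel_measure L g \<omega>) A = ennreal (g \<omega> A)"
proof -
  have "measure_space UNIV (coord_sets (- pos_future L)) (\<lambda>A. ennreal (g \<omega> A))"
    using assms(1) by (simp add: proper_oriented_kernel_def)
  then show ?thesis
    unfolding kernel_measure_def measure_space_def
    by (intro emeasure_measure_of_sigma assms(2)) auto
qed

lemma prob_space_kernel_measure:
  assumes "proper_oriented_kernel L g"
  shows "prob_space (kernel_measure L g \<omega>)"
proof (rule prob_spaceI)
  have "UNIV \<in> coord_sets (- pos_future L)"
    using sigma_algebra.axioms(1)[OF sigma_algebra_coord_sets] by (rule algebra.top)
  with emeasure_kernel_measure[OF assms this] assms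
  show "emeasure (kernel_measure L g \<omega>) (space (kernel_measure L g \<omega>)) = 1"
    by (simp add: proper_oriented_kernel_def)
qed

text \<open>For a POMM, \<open>embed_pmf\<close> is faithful here by \<open>pmf_site_pmf\<close>,
  and the result is the law of the colour at \<open>x\<close> under the kernel of \<open>{x}\<close>
  (\<open>distr_site_kernel\<close>).\<close>

definition site_pmf :: "('a::order set \<Rightarrow> ('a \<Rightarrow> 'e) \<Rightarrow> ('a \<Rightarrow> 'e) set \<Rightarrow> real)
    \<Rightarrow> 'a \<Rightarrow> ('a \<Rightarrow> 'e) \<Rightarrow> 'e pmf" where
  "site_pmf \<gamma> x \<omega> = embed_pmf (\<lambda>a. single_site \<gamma> x a \<omega>)"

text \<open>The action of the kernel of \<open>{x}\<close> on bounded functions of finitely many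
  sites not above \<open>x\<close>, by \<open>nn_integral_site_kernel\<close>. No measurability of
  \<open>f\<close> is required, since a \<open>pmf\<close> lives on the discrete
  sigma-algebra.\<close>

definition site_avg :: "('a::order set \<Rightarrow> ('a \<Rightarrow> 'e) \<Rightarrow> ('a \<Rightarrow> 'e) set \<Rightarrow> real)
    \<Rightarrow> 'a \<Rightarrow> (('a \<Rightarrow> 'e) \<Rightarrow> real) \<Rightarrow> ('a \<Rightarrow> 'e) \<Rightarrow> real" where
  "site_avg \<gamma> x f \<omega> = (\<integral>a. f (fun_upd \<omega> x a) \<partial>site_pmf \<gamma> x \<omega>)"

lemma site_avg_bounds:
  assumes "\<And>\<omega>. 0 \<le> f \<omega>" "\<And>\<omega>. f \<omega> \<le> 1"
  shows "0 \<le> site_avg \<gamma> x f \<omega>" "site_avg \<gamma> x f \<omega> \<le> 1"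
proof -
  have "integrable (site_pmf \<gamma> x \<omega>) (\<lambda>a. f (fun_upd \<omega> x a))"
    by (rule measure_pmf.integrable_const_bound[where B=1]) (auto simp: assms)
  then show "site_avg \<gamma> x f \<omega> \<le> 1"
    unfolding site_avg_def by (rule measure_pmf.integral_le_const) (simp add: assms)
  show "0 \<le> site_avg \<gamma> x f \<omega>"
    unfolding site_avg_def by (rule Bochner_Integration.integral_nonneg) (simp add: assms)
qed

context
  fixes \<gamma> :: "'a::order set \<Rightarrow> ('a \<Rightarrow> 'e::countable) \<Rightarrow> ('a \<Rightarrow> 'e) set \<Rightarrow> real"
  assumes pomm: "POMM \<gamma>"
begin

lemma POMM_site_kernel: "proper_oriented_kernel {x} (\<gamma> {x})"
  using pomm time_box_singleton by (auto simp: POMM_def POS_def)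

lemma measurable_coordinate_site_kernel:
  "(\<lambda>\<sigma>. \<sigma> x) \<in> measurable (kernel_measure {x} (\<gamma> {x}) \<omega>) (count_space UNIV)"
proof (rule measurableI)
  fix A :: "'e set"
  have "{\<sigma>. \<sigma> x \<in> A} \<in> coord_sets (- pos_future {x})"
    by (rule coord_sets_coordinate) (simp add: pos_future_singleton)
  then show "(\<lambda>\<sigma>. \<sigma> x) -` A \<inter> space (kernel_measure {x} (\<gamma> {x}) \<omega>)
      \<in> sets (kernel_measure {x} (\<gamma> {x}) \<omega>)"
    by (simp add: vimage_def)
qed simp

lemma emeasure_distr_site_kernel:
  "emeasure (distr (kernel_measure {x} (\<gamma> {x}) \<omega>) (count_space UNIV) (\<lambda>\<sigma>. \<sigma> x)) {a}
    = ennreal (single_site \<gamma> x a \<omega>)"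
proof -
  have "{\<sigma>. \<sigma> x \<in> {a}} \<in> coord_sets (- pos_future {x})"
    by (rule coord_sets_coordinate) (simp add: pos_future_singleton)
  from emeasure_kernel_measure[OF POMM_site_kernel this, of \<omega>] show ?thesis
    by (subst emeasure_distr[OF measurable_coordinate_site_kernel])
       (simp_all add: single_site_def vimage_def)
qed

text \<open>The colour space is countable, so the masses of the single colours add up to the total
  mass of the marginal at \<open>x\<close>.\<close>

lemma pmf_site_pmf: "pmf (site_pmf \<gamma> x \<omega>) a = single_site \<gamma> x a \<omega>"
  unfolding site_pmf_def
proof (rule pmf_embed_pmf)
  fix a :: 'e
  have "{\<sigma>. \<sigma> x \<in> {a}} \<in> coord_sets (- pos_future {x})"
    by (rule coord_sets_coordinate) (simp add: pos_future_singleton)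
  with POMM_site_kernel[of x] show "0 \<le> single_site \<gamma> x a \<omega>"
    by (simp add: single_site_def proper_oriented_kernel_def)
next
  interpret K: prob_space "kernel_measure {x} (\<gamma> {x}) \<omega>"
    by (rule prob_space_kernel_measure[OF POMM_site_kernel])
  interpret D: prob_space "distr (kernel_measure {x} (\<gamma> {x}) \<omega>) (count_space UNIV) (\<lambda>\<sigma>. \<sigma> x)"
    by (rule K.prob_space_distr[OF measurable_coordinate_site_kernel])
  have "(\<integral>\<^sup>+a. ennreal (single_site \<gamma> x a \<omega>) \<partial>count_space UNIV)
      = emeasure (distr (kernel_measure {x} (\<gamma> {x}) \<omega>) (count_space UNIV) (\<lambda>\<sigma>. \<sigma> x)) UNIV"
    by (subst emeasure_countable_singleton) (simp_all add: emeasure_distr_site_kernel)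
  also have "\<dots> = 1" using D.emeasure_space_1 by simp
  finally show "(\<integral>\<^sup>+a. ennreal (single_site \<gamma> x a \<omega>) \<partial>count_space UNIV) = 1" .
qed

lemma distr_site_kernel:
  "distr (kernel_measure {x} (\<gamma> {x}) \<omega>) (count_space UNIV) (\<lambda>\<sigma>. \<sigma> x) = measure_pmf (site_pmf \<gamma> x \<omega>)"
  by (rule measure_eqI_countable[where A=UNIV])
     (simp_all add: emeasure_distr_site_kernel emeasure_pmf_single pmf_site_pmf)

text \<open>The Markov property enters here: the mass of each colour is measurable with respect to
  \<open>near_past {x}\<close>, which is \<open>near_past_pt x\<close>, and is therefore a function
  of these coordinates.\<close>

lemma site_pmf_cong:
  assumes "\<And>y. y \<in> near_past_pt x \<Longrightarrow> \<eta> y = \<xi> y"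
  shows "site_pmf \<gamma> x \<eta> = site_pmf \<gamma> x \<xi>"
proof (rule pmf_eqI)
  fix a :: 'e
  have "{\<sigma>. \<sigma> x \<in> {a}} \<in> coord_sets {x}"
    by (rule coord_sets_coordinate) simp
  then have "meas_wrt (near_past_pt x) (\<lambda>\<omega>. single_site \<gamma> x a \<omega>)"
    using pomm time_box_singleton[of x] unfolding POMM_def single_site_def
    by (auto simp flip: near_past_singleton)
  from depends_onD[OF meas_wrt_imp_depends_on[OF this] assms]
  show "pmf (site_pmf \<gamma> x \<eta>) a = pmf (site_pmf \<gamma> x \<xi>) a"
    by (simp add: pmf_site_pmf)
qed

text \<open>\<open>perc_param\<close> is an iterated supremum of reals, so every estimate needs
  boundedness first; it holds because total variation distances lie between 0 and 1.\<close>

lemma half_infsum_site_pmf_le_perc_param: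
  "(1/2) * (\<Sum>\<^sub>\<infinity>a. \<bar>pmf (site_pmf \<gamma> x \<eta>) a - pmf (site_pmf \<gamma> x \<xi>) a\<bar>) \<le> perc_param \<gamma> x"
  and perc_param_bounds: "0 \<le> perc_param \<gamma> x" "perc_param \<gamma> x \<le> 1"
proof -
  define d where "d \<eta> \<xi> = (1/2) * (\<Sum>\<^sub>\<infinity>a. \<bar>pmf (site_pmf \<gamma> x \<eta>) a - pmf (site_pmf \<gamma> x \<xi>) a\<bar>)" for \<eta> \<xi>
  have p: "perc_param \<gamma> x = (SUP \<eta>. SUP \<xi>. d \<eta> \<xi>)"
    by (simp add: perc_param_def d_def pmf_site_pmf)
  have d: "0 \<le> d \<eta> \<xi>" "d \<eta> \<xi> \<le> 1" for \<eta> \<xi>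
    unfolding d_def by (rule half_infsum_abs_pmf_diff_bounds)+
  have 1: "d \<eta> \<xi> \<le> (SUP \<xi>. d \<eta> \<xi>)" for \<eta> \<xi>
    by (rule cSUP_upper) (auto intro: bdd_aboveI2[of _ _ 1] d)
  have 2: "(SUP \<xi>. d \<eta> \<xi>) \<le> 1" for \<eta>
    by (rule cSUP_least) (auto intro: d)
  have 3: "(SUP \<xi>. d \<eta> \<xi>) \<le> perc_param \<gamma> x" for \<eta>
    unfolding p by (rule cSUP_upper) (auto intro: bdd_aboveI2[of _ _ 1] 2)
  show "perc_param \<gamma> x \<le> 1"
    unfolding p by (rule cSUP_least) (auto intro: 2)
  have 4: "d \<eta> \<xi> \<le> perc_param \<gamma> x" for \<eta> \<xi>
    using 1 3 by (rule order_trans)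
  then show "0 \<le> perc_param \<gamma> x"
    using d(1) order_trans by blast
  show "(1/2) * (\<Sum>\<^sub>\<infinity>a. \<bar>pmf (site_pmf \<gamma> x \<eta>) a - pmf (site_pmf \<gamma> x \<xi>) a\<bar>) \<le> perc_param \<gamma> x"
    using 4[of \<eta> \<xi>] by (simp add: d_def)
qed

text \<open>The sites of \<open>U\<close> other than \<open>x\<close> are in the past or the outer
  time of \<open>{x}\<close>. Properness freezes them almost surely, so that only the colour at
  \<open>x\<close> remains random.\<close>

lemma nn_integral_site_kernel:
  assumes "finite U" "depends_on U f" "\<And>y. y \<in> U \<Longrightarrow> \<not> x < y"
    and f: "\<And>\<omega>. 0 \<le> f \<omega>" "\<And>\<omega>. f \<omega> \<le> 1"
  shows "(\<integral>\<^sup>+\<sigma>. ennreal (f \<sigma>) \<partial>kernel_measure {x} (\<gamma> {x}) \<omega>) = ennreal (site_avg \<gamma> x f \<omega>)"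
proof -
  let ?K = "kernel_measure {x} (\<gamma> {x}) \<omega>"
  interpret K: prob_space ?K
    by (rule prob_space_kernel_measure[OF POMM_site_kernel])
  \<comment> \<open>The event that no site of \<open>U\<close> except possibly \<open>x\<close> has
    changed. It is decided by the past and the outer time of \<open>{x}\<close>, so its kernel mass
    is \<open>indicator B \<omega>\<close>, which is 1.\<close>
  define B where "B = {\<sigma>. \<forall>u\<in>U - {x}. \<sigma> u = \<omega> u}"
  have "U - {x} \<subseteq> pos_past {x} \<union> pos_outer {x}"
    using assms(3) by (auto simp: pos_past_def pos_outer_def less_le)
  moreover have "B \<in> coord_sets (U - {x})"
    using assms(1) by (intro depends_on_imp_coord_sets) (auto simp: depends_on_def B_def)
  ultimately have B: "B \<in> coord_sets (pos_past {x} \<union> pos_outer {x})"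
    using coord_sets_mono by blast
  moreover have "pos_past {x} \<union> pos_outer {x} \<subseteq> - pos_future {x}"
    by (auto simp: pos_past_def pos_outer_def pos_future_def)
  ultimately have B': "B \<in> coord_sets (- pos_future {x})"
    using coord_sets_mono by blast
  have "\<gamma> {x} \<omega> B = 1"
    using POMM_site_kernel[of x] B by (simp add: proper_oriented_kernel_def B_def)
  then have "emeasure ?K B = 1"
    using emeasure_kernel_measure[OF POMM_site_kernel B', of \<omega>] by simp
  then have "AE \<sigma> in ?K. \<sigma> \<in> B"
    using B' by (subst K.AE_in_set_eq_1) (simp_all add: measure_def)
  then have "(\<integral>\<^sup>+\<sigma>. ennreal (f \<sigma>) \<partial>?K) = (\<integral>\<^sup>+\<sigma>. ennreal (f (fun_upd \<omega> x (\<sigma> x))) \<partial>?K)"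
    by (intro nn_integral_cong_AE, elim AE_mp)
       (auto intro!: AE_I2 arg_cong[where f=ennreal] depends_onD[OF assms(2)] simp: B_def)
  also have "\<dots> = (\<integral>\<^sup>+a. ennreal (f (fun_upd \<omega> x a)) \<partial>site_pmf \<gamma> x \<omega>)"
    by (subst distr_site_kernel[symmetric], subst nn_integral_distr[OF measurable_coordinate_site_kernel]) auto
  also have "\<dots> = ennreal (site_avg \<gamma> x f \<omega>)"
    unfolding site_avg_def
    by (intro nn_integral_eq_integral measure_pmf.integrable_const_bound[where B=1]) (auto simp: f)
  finally show ?thesis .
qed

text \<open>Consistency speaks about events. To pass to functions, \<open>\<mu>\<close> is composed
  with the kernel by \<open>bind\<close>, and the result is compared with \<open>\<mu>\<close> on
  the sigma-algebra of the sites not above \<open>x\<close>.\<close>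

lemma consistent_chain_nn_integral_site_avg:
  assumes \<mu>: "\<mu> \<in> consistent_chains \<gamma>"
    and "finite U" "depends_on U f" "\<And>y. y \<in> U \<Longrightarrow> \<not> x < y"
    and f: "\<And>\<omega>. 0 \<le> f \<omega>" "\<And>\<omega>. f \<omega> \<le> 1"
  shows "(\<integral>\<^sup>+\<omega>. ennreal (f \<omega>) \<partial>\<mu>) = (\<integral>\<^sup>+\<omega>. ennreal (site_avg \<gamma> x f \<omega>) \<partial>\<mu>)"
proof -
  let ?K = "kernel_measure {x} (\<gamma> {x})"
  define N :: "('a \<Rightarrow> 'e) measure" where "N = sigma UNIV (coord_sets (- pos_future {x}))"
  have sN: "sets N = coord_sets (- pos_future {x})"
    by (simp add: N_def sigma_algebra.sets_measure_of_eq[OF sigma_algebra_coord_sets])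
  have spN: "space N = UNIV" by (simp add: N_def)
  interpret \<mu>: prob_space \<mu> using \<mu> by (simp add: consistent_chains_def)
  have s\<mu>: "sets \<mu> = coord_sets UNIV" and sp\<mu>: "space \<mu> = UNIV"
    and cons: "\<And>A. A \<in> coord_sets (- pos_future {x}) \<Longrightarrow> (\<integral>\<sigma>. \<gamma> {x} \<sigma> A \<partial>\<mu>) = measure \<mu> A"
    using \<mu> time_box_singleton[of x] by (auto simp: consistent_chains_def)
  have mg: "(\<lambda>\<sigma>. \<gamma> {x} \<sigma> A) \<in> borel_measurable \<mu>" if "A \<in> coord_sets (- pos_future {x})" for A
  proof (rule measurableI)
    fix B :: "real set" assume "B \<in> sets borel"
    then have "(\<lambda>\<sigma>. \<gamma> {x} \<sigma> A) -` B \<in> coord_sets (pos_past {x} \<union> pos_outer {x})"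
      using POMM_site_kernel[of x] that by (simp add: proper_oriented_kernel_def meas_wrt_def)
    then show "(\<lambda>\<sigma>. \<gamma> {x} \<sigma> A) -` B \<inter> space \<mu> \<in> sets \<mu>"
      using coord_sets_mono[of _ UNIV] by (auto simp: sp\<mu> s\<mu>)
  qed simp
  have K: "?K \<in> measurable \<mu> (subprob_algebra N)"
  proof (rule measurable_subprob_algebra)
    show "subprob_space (?K \<omega>)" for \<omega>
      by (intro prob_space_imp_subprob_space prob_space_kernel_measure POMM_site_kernel)
    show "(\<lambda>\<omega>. emeasure (?K \<omega>) A) \<in> borel_measurable \<mu>" if "A \<in> sets N" for A
      using that mg[of A] by (simp add: emeasure_kernel_measure[OF POMM_site_kernel] sN)
  qed (simp add: sN)
  \<comment> \<open>\<open>distr\<close> along the identity into \<open>N\<close> is the restriction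
    of \<open>\<mu>\<close> to the smaller sigma-algebra.\<close>
  have id: "(\<lambda>\<omega>. \<omega>) \<in> measurable \<mu> N"
    using coord_sets_mono[of "- pos_future {x}" UNIV]
    by (intro measurableI) (auto simp: sN spN sp\<mu> s\<mu>)
  have "\<mu> \<bind> ?K = distr \<mu> N (\<lambda>\<omega>. \<omega>)"
  proof (rule measure_eqI)
    show sb: "sets (\<mu> \<bind> ?K) = sets (distr \<mu> N (\<lambda>\<omega>. \<omega>))"
      by (subst sets_bind[where N=N]) (simp_all add: sN sp\<mu>)
    fix A assume "A \<in> sets (\<mu> \<bind> ?K)"
    then have A: "A \<in> coord_sets (- pos_future {x})" by (simp add: sb sN)
    have nn: "0 \<le> \<gamma> {x} \<sigma> A" for \<sigma>
      using POMM_site_kernel[of x] A by (simp add: proper_oriented_kernel_def)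
    have le: "\<gamma> {x} \<sigma> A \<le> 1" for \<sigma>
    proof -
      interpret prob_space "?K \<sigma>" by (rule prob_space_kernel_measure[OF POMM_site_kernel])
      have "ennreal (\<gamma> {x} \<sigma> A) \<le> 1"
        using emeasure_le_1[of A] by (simp add: emeasure_kernel_measure[OF POMM_site_kernel A])
      then show ?thesis by simp
    qed
    have "emeasure (\<mu> \<bind> ?K) A = (\<integral>\<^sup>+\<sigma>. ennreal (\<gamma> {x} \<sigma> A) \<partial>\<mu>)"
      using A by (subst emeasure_bind[OF _ K])
        (simp_all add: sN sp\<mu> emeasure_kernel_measure[OF POMM_site_kernel])
    also have "\<dots> = ennreal (\<integral>\<sigma>. \<gamma> {x} \<sigma> A \<partial>\<mu>)"
      using mg[OF A] nn le
      by (intro nn_integral_eq_integral \<mu>.integrable_const_bound[where B=1]) auto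
    also have "\<dots> = emeasure (distr \<mu> N (\<lambda>\<omega>. \<omega>)) A"
      using A by (subst emeasure_distr[OF id]) (simp_all add: cons \<mu>.emeasure_eq_measure sN sp\<mu>)
    finally show "emeasure (\<mu> \<bind> ?K) A = emeasure (distr \<mu> N (\<lambda>\<omega>. \<omega>)) A" .
  qed
  moreover have "f \<in> borel_measurable N"
    using assms(4) by (intro depends_on_imp_measurable[OF assms(2,3) _ sN])
      (auto simp: pos_future_singleton)
  then have fm: "(\<lambda>\<omega>. ennreal (f \<omega>)) \<in> borel_measurable N" by simp
  ultimately have "(\<integral>\<^sup>+\<omega>. ennreal (f \<omega>) \<partial>\<mu>) = (\<integral>\<^sup>+\<omega>. ennreal (f \<omega>) \<partial>(\<mu> \<bind> ?K))"
    using nn_integral_distr[OF id, of "\<lambda>\<omega>. ennreal (f \<omega>)"] by simp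
  also have "\<dots> = (\<integral>\<^sup>+\<omega>. ennreal (site_avg \<gamma> x f \<omega>) \<partial>\<mu>)"
    by (simp add: nn_integral_bind[OF fm K] nn_integral_site_kernel[OF assms(2-4) f])
  finally show ?thesis .
qed

end

subsection \<open>Bernoulli percolation\<close>

lemma sets_bernoulli_field: "sets (bernoulli_field p) = coord_sets UNIV"
  unfolding bernoulli_field_def coord_sets_eq_sets_PiM by (rule sets_PiM_cong) auto

lemma space_bernoulli_field: "space (bernoulli_field p) = UNIV"
  unfolding bernoulli_field_def space_PiM by simp

lemma prob_space_bernoulli_field: "prob_space (bernoulli_field p)"
  unfolding bernoulli_field_def by (rule prob_space_PiM) (rule measure_pmf.prob_space_axioms)

text \<open>The product structure splits off the coordinate \<open>x\<close>. The formula
  \<open>eq\<close> is applied to \<open>F\<close> and to its average over the state of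
  \<open>x\<close>; a coordinate overwritten twice keeps the second value, so both give the same
  iterated integral.\<close>

lemma bernoulli_field_nn_integral_resample:
  assumes "F \<in> borel_measurable (bernoulli_field p)"
  shows "(\<integral>\<^sup>+X. F X \<partial>bernoulli_field p)
    = (\<integral>\<^sup>+X. (\<integral>\<^sup>+b. F (fun_upd X x b) \<partial>bernoulli_pmf (p x)) \<partial>bernoulli_field p)"
proof -
  let ?B = "\<lambda>x. measure_pmf (bernoulli_pmf (p x))"
  define R where "R = PiM (UNIV - {x}) ?B"
  have ins: "insert x (UNIV - {x}) = UNIV" by auto
  have D: "distr (?B x \<Otimes>\<^sub>M R) (bernoulli_field p) (\<lambda>(b, X). fun_upd X x b) = bernoulli_field p"
    using distr_pair_PiM_eq_PiM[of "UNIV - {x}" ?B x]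
    by (simp add: ins R_def bernoulli_field_def measure_pmf.prob_space_axioms)
  have m: "(\<lambda>(b, X). fun_upd X x b) \<in> measurable (?B x \<Otimes>\<^sub>M R) (bernoulli_field p)"
    unfolding R_def bernoulli_field_def by (subst (2) ins[symmetric]) measurable
  interpret R: prob_space R
    unfolding R_def by (rule prob_space_PiM) (rule measure_pmf.prob_space_axioms)
  interpret P: pair_sigma_finite "?B x" R ..
  have eq: "(\<integral>\<^sup>+X. G X \<partial>bernoulli_field p) = (\<integral>\<^sup>+X. (\<integral>\<^sup>+b. G (fun_upd X x b) \<partial>?B x) \<partial>R)"
    if G: "G \<in> borel_measurable (bernoulli_field p)" for G
  proof -
    have "(\<integral>\<^sup>+X. G X \<partial>bernoulli_field p) = (\<integral>\<^sup>+z. G (case z of (b, X) \<Rightarrow> fun_upd X x b) \<partial>(?B x \<Otimes>\<^sub>M R))"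
      by (subst D[symmetric], subst nn_integral_distr[OF m]) (use G in auto)
    also have "\<dots> = (\<integral>\<^sup>+X. (\<integral>\<^sup>+b. G (fun_upd X x b) \<partial>?B x) \<partial>R)"
      using measurable_compose[OF m G] by (subst P.nn_integral_snd[symmetric]) auto
    finally show ?thesis .
  qed
  have "(\<lambda>X. \<integral>\<^sup>+b. F (fun_upd X x b) \<partial>?B x) \<in> borel_measurable (bernoulli_field p)"
  proof -
    have "(\<lambda>X. fun_upd X x b) \<in> measurable (bernoulli_field p) (bernoulli_field p)" for b
      unfolding bernoulli_field_def by (rule measurable_fun_upd[where J=UNIV]) auto
    from measurable_compose[OF this assms] show ?thesis
      by (subst nn_integral_measure_pmf_support[where A=UNIV]) (auto simp: UNIV_bool)
  qed
  from eq[OF this] eq[OF assms] show ?thesis by simp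
qed

lemma bernoulli_field_integral_resample:
  fixes F :: "('a \<Rightarrow> bool) \<Rightarrow> real"
  assumes F: "finite U" "depends_on U F" "\<And>X. 0 \<le> F X" "\<And>X. F X \<le> 1"
    and p: "0 \<le> p x" "p x \<le> 1"
  shows "(\<integral>X. F X \<partial>bernoulli_field p)
    = (\<integral>X. p x * F (fun_upd X x True) + (1 - p x) * F (fun_upd X x False) \<partial>bernoulli_field p)"
proof -
  interpret prob_space "bernoulli_field p" by (rule prob_space_bernoulli_field)
  have meas: "G \<in> borel_measurable (bernoulli_field p)" if "depends_on U G" for G :: "_ \<Rightarrow> real"
    using F(1) that by (rule depends_on_imp_measurable[OF _ _ _ sets_bernoulli_field]) auto
  define H where "H X = p x * F (fun_upd X x True) + (1 - p x) * F (fun_upd X x False)" for X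
  have H01: "0 \<le> H X" "H X \<le> 1" for X
    using F(3,4) p unfolding H_def by (auto intro!: convex_bound_le)
  have dep: "depends_on U H"
    unfolding H_def
    by (rule depends_onI, intro arg_cong2[where f="(+)"] arg_cong2[where f="(*)"] refl
          depends_onD[OF F(2)]) auto
  have "ennreal (\<integral>X. F X \<partial>bernoulli_field p) = (\<integral>\<^sup>+X. ennreal (F X) \<partial>bernoulli_field p)"
    by (intro nn_integral_eq_integral[symmetric] integrable_const_bound[where B=1])
       (auto simp: F meas)
  also have "\<dots> = (\<integral>\<^sup>+X. (\<integral>\<^sup>+b. ennreal (F (fun_upd X x b)) \<partial>bernoulli_pmf (p x)) \<partial>bernoulli_field p)"
    using meas[OF F(2)] by (intro bernoulli_field_nn_integral_resample) simp
  also have "\<dots> = (\<integral>\<^sup>+X. ennreal (H X) \<partial>bernoulli_field p)"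
  proof (rule nn_integral_cong)
    fix X
    have "(\<integral>\<^sup>+b. ennreal (F (fun_upd X x b)) \<partial>bernoulli_pmf (p x))
        = ennreal (F (fun_upd X x True)) * ennreal (p x) + ennreal (F (fun_upd X x False)) * ennreal (1 - p x)"
      by (subst nn_integral_measure_pmf_support[where A=UNIV]) (auto simp: UNIV_bool p)
    also have "\<dots> = ennreal (H X)"
      using F(3,4) p by (simp add: H_def ennreal_mult' ennreal_plus mult.commute)
    finally show "(\<integral>\<^sup>+b. ennreal (F (fun_upd X x b)) \<partial>bernoulli_pmf (p x)) = ennreal (H X)" .
  qed
  also have "\<dots> = ennreal (\<integral>X. H X \<partial>bernoulli_field p)"
    by (intro nn_integral_eq_integral integrable_const_bound[where B=1])
       (auto simp: H01 meas[OF dep])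
  finally show ?thesis
    unfolding H_def[symmetric]
    by (subst (asm) ennreal_inj) (auto intro!: Bochner_Integration.integral_nonneg F H01)
qed

section \<open>Long open paths and Koenig's lemma\<close>

text \<open>For positive \<open>n\<close> this asks for \<open>n\<close> open sites along
  nearest-past steps and one further step to a site in any state. Only finite depth is involved, so
  that these events are measurable when nearest pasts are finite.\<close>

fun long_open_path :: "nat \<Rightarrow> ('a::order \<Rightarrow> bool) \<Rightarrow> 'a \<Rightarrow> bool" where
  "long_open_path 0 X x = True"
| "long_open_path (Suc n) X x = (X x \<and> (\<exists>y\<in>near_past_pt x. long_open_path n X y))"

lemma long_open_path_Suc_imp: "long_open_path (Suc n) X x \<Longrightarrow> long_open_path n X x"
  by (induction n arbitrary: x) (simp, metis long_open_path.simps(2))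

lemma long_open_path_antimono: "m \<le> n \<Longrightarrow> long_open_path n X x \<Longrightarrow> long_open_path m X x"
  by (induction n rule: dec_induct) (auto dest: long_open_path_Suc_imp simp del: long_open_path.simps)

text \<open>The pigeonhole step of Koenig's lemma: if each \<open>v\<close> failed at some level,
  all of them would fail at the sum of these levels.\<close>

lemma finite_antimono_swap:
  assumes "finite V" "\<And>m n v. m \<le> n \<Longrightarrow> P n v \<Longrightarrow> P (m::nat) v" "\<forall>n. \<exists>v\<in>V. P n v"
  shows "\<exists>v\<in>V. \<forall>n. P n v"
proof (rule ccontr)
  assume "\<not> ?thesis"
  then have "\<forall>v\<in>V. \<exists>n. \<not> P n v" by simp
  then obtain N where N: "\<forall>v\<in>V. \<not> P (N v) v" by metis
  obtain v where "v \<in> V" "P (\<Sum>v\<in>V. N v) v" using assms(3) by blast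
  moreover have "N v \<le> (\<Sum>v\<in>V. N v)"
    using \<open>finite V\<close> \<open>v \<in> V\<close> by (simp add: member_le_sum)
  ultimately show False using N assms(2) by blast
qed

text \<open>Koenig's lemma. The property \<open>Q\<close> of having open paths of every length
  passes from a site to some site in its finite nearest past, and iterated choice gives an infinite
  open path \<open>g\<close>.\<close>

lemma percolates_from_if_long_open_paths:
  fixes x :: "'a::order"
  assumes fin: "\<And>x::'a. finite (near_past_pt x)" and all: "\<And>n. long_open_path n X x"
  shows "percolates_from X x"
proof -
  define Q where "Q z \<longleftrightarrow> (\<forall>n. long_open_path n X z)" for z
  have step: "\<exists>y. y \<in> near_past_pt z \<and> Q y" if "Q z" for z
  proof -
    have each: "\<forall>n. \<exists>y\<in>near_past_pt z. long_open_path n X y"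
      using that unfolding Q_def by (metis long_open_path.simps(2))
    have "\<exists>y\<in>near_past_pt z. \<forall>n. long_open_path n X y"
      by (rule finite_antimono_swap[where P="\<lambda>n v. long_open_path n X v", OF fin _ each])
         (rule long_open_path_antimono)
    then show ?thesis unfolding Q_def by blast
  qed
  define g where "g = rec_nat x (\<lambda>_ z. SOME y. y \<in> near_past_pt z \<and> Q y)"
  have Qg: "Q (g n)" for n
  proof (induction n)
    case 0
    then show ?case using all by (simp add: Q_def g_def)
  next
    case (Suc n)
    from someI_ex[OF step[OF this]] show ?case by (simp add: g_def)
  qed
  have g: "g (Suc n) \<in> near_past_pt (g n)" for n
    using someI_ex[OF step[OF Qg[of n]]] by (simp add: g_def)
  have X: "X (g n)" for n
    using Qg[of n] unfolding Q_def by (metis long_open_path.simps(2))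
  have less: "g (Suc n) < g n" for n
    using g near_past_pt_less by blast
  \<comment> \<open>\<open>open_path\<close> demands a strictly smaller end point, so the
    percolating sequence starts with \<open>g 1\<close>, not with \<open>g 0\<close>.\<close>
  have "g (Suc n) < g 0" for n
    by (induction n) (use less in \<open>auto intro: less_trans\<close>)
  moreover have g0: "g 0 = x" by (simp add: g_def)
  moreover have "\<exists>xs. xs \<noteq> [] \<and> hd xs = g 0 \<and> last xs = g (Suc n)
        \<and> (\<forall>k. Suc k < length xs \<longrightarrow> xs ! Suc k \<in> near_past_pt (xs ! k)) \<and> (\<forall>z\<in>set xs. X z)" for n
    by (rule exI[of _ "map g [0..<Suc (Suc n)]"])
       (use g X in \<open>auto simp: hd_map last_map nth_append simp del: upt_Suc\<close>)
  ultimately have "open_path X x (g (Suc n))" for n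
    unfolding open_path_def by metis
  then show ?thesis
    unfolding percolates_from_def using less by (intro exI[of _ "\<lambda>n. g (Suc n)"]) auto
qed

lemma measurable_long_open_path:
  fixes x :: "'a::order"
  assumes fin: "\<And>x::'a. finite (near_past_pt x)"
  shows "{X. long_open_path n X x} \<in> sets (bernoulli_field p)"
proof (induction n arbitrary: x)
  case 0
  then show ?case using sets.top[of "bernoulli_field p"] by (simp add: space_bernoulli_field)
next
  case (Suc n)
  have "{X. long_open_path (Suc n) X x} = {X. X x \<in> {True}} \<inter> (\<Union>y\<in>near_past_pt x. {X. long_open_path n X y})"
    by auto
  also have "\<dots> \<in> sets (bernoulli_field p)"
    by (intro sets.Int sets.finite_UN fin Suc.IH, unfold sets_bernoulli_field)
       (rule coord_sets_coordinate, simp)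
  finally show ?case .
qed

text \<open>The events decrease in \<open>n\<close>. On their intersection a single \<open>v\<close>
  has open paths of every length, as \<open>V\<close> is finite, and hence percolates; the
  intersection is null and continuity from above applies.\<close>

lemma long_open_path_prob_tendsto_0:
  fixes p :: "'a::order \<Rightarrow> real"
  assumes fin: "\<And>x::'a. finite (near_past_pt x)" and "non_percolating p" "finite V"
  shows "(\<lambda>n. measure (bernoulli_field p) {X. \<exists>v\<in>V. long_open_path n X v}) \<longlonglongrightarrow> 0"
proof -
  interpret prob_space "bernoulli_field p" by (rule prob_space_bernoulli_field)
  define A where "A n = {X. \<exists>v\<in>V. long_open_path n X v}" for n
  have A: "range A \<subseteq> events"
  proof clarify
    fix n
    have "A n = (\<Union>v\<in>V. {X. long_open_path n X v})" by (auto simp: A_def)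
    then show "A n \<in> events"
      using \<open>finite V\<close> measurable_long_open_path[OF fin] by auto
  qed
  have "decseq A"
    unfolding decseq_def A_def using long_open_path_antimono by blast
  from finite_Lim_measure_decseq[OF A this]
  have "(\<lambda>n. prob (A n)) \<longlonglongrightarrow> prob (\<Inter>n. A n)" .
  moreover have "AE X in bernoulli_field p. \<forall>v\<in>V. \<not> percolates_from X v"
    using assms(2,3) by (auto simp: non_percolating_def AE_finite_all)
  then have "AE X in bernoulli_field p. X \<notin> (\<Inter>n. A n)"
  proof (rule AE_mp, intro AE_I2 impI notI)
    fix X assume "\<forall>v\<in>V. \<not> percolates_from X v" "X \<in> (\<Inter>n. A n)"
    then have each: "\<forall>n. \<exists>v\<in>V. long_open_path n X v" by (auto simp: A_def)
    have "\<exists>v\<in>V. \<forall>n. long_open_path n X v"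
      by (rule finite_antimono_swap[where P="\<lambda>n v. long_open_path n X v", OF \<open>finite V\<close> _ each])
         (rule long_open_path_antimono)
    then obtain v where "v \<in> V" "\<forall>n. long_open_path n X v" by blast
    with percolates_from_if_long_open_paths[OF fin, of X v] \<open>\<forall>v\<in>V. \<not> percolates_from X v\<close>
    show False by blast
  qed
  then have "prob (\<Inter>n. A n) = 0"
    using A by (subst prob_eq_0) auto
  ultimately show ?thesis by (simp add: A_def)
qed

subsection \<open>Propagation of disagreement\<close>

text \<open>For bounded \<open>f\<close>, the least function of the coordinates in \<open>R\<close>
  that dominates \<open>f\<close>.\<close>

definition sup_given :: "'a set \<Rightarrow> (('a \<Rightarrow> 'e) \<Rightarrow> real) \<Rightarrow> ('a \<Rightarrow> 'e) \<Rightarrow> real" where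
  "sup_given R f \<omega> = (SUP \<sigma>\<in>{\<sigma>. \<forall>y\<in>R. \<sigma> y = \<omega> y}. f \<sigma>)"

lemma sup_given_upper:
  assumes "\<And>\<omega>. f \<omega> \<le> 1" "\<And>y. y \<in> R \<Longrightarrow> \<sigma> y = \<omega> y"
  shows "f \<sigma> \<le> sup_given R f \<omega>"
  unfolding sup_given_def by (rule cSUP_upper) (auto intro: bdd_aboveI2[of _ _ 1] assms)

lemma sup_given_least:
  assumes "\<And>\<sigma>. (\<And>y. y \<in> R \<Longrightarrow> \<sigma> y = \<omega> y) \<Longrightarrow> f \<sigma> \<le> c"
  shows "sup_given R f \<omega> \<le> c"
  unfolding sup_given_def by (rule cSUP_least) (auto intro: assms)

lemma sup_given_bounds:
  assumes "\<And>\<omega>. 0 \<le> f \<omega>" "\<And>\<omega>. f \<omega> \<le> 1"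
  shows "0 \<le> sup_given R f \<omega>" "sup_given R f \<omega> \<le> 1"
proof -
  show "0 \<le> sup_given R f \<omega>"
    using assms(1)[of \<omega>] sup_given_upper[of f R \<omega> \<omega>] assms(2) by simp
  show "sup_given R f \<omega> \<le> 1"
    by (rule sup_given_least) (rule assms(2))
qed

lemma depends_on_sup_given: "depends_on R (sup_given R f)"
  unfolding sup_given_def by (rule depends_onI) (simp cong: ball_cong)

text \<open>Averaging over \<open>x\<close> makes the function depend on the nearest past of \<open>x\<close>, part of which may lie
  outside \<open>ws\<close>. Taking the supremum over these sites keeps it a function of the remaining list; this
  is needed because a site outside \<open>ws\<close> may lie above the next site of the list, whose kernel
  could then no longer be applied.\<close>

fun iter_upper :: "('a::order set \<Rightarrow> ('a \<Rightarrow> 'e) \<Rightarrow> ('a \<Rightarrow> 'e) set \<Rightarrow> real)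
    \<Rightarrow> 'a list \<Rightarrow> (('a \<Rightarrow> 'e) \<Rightarrow> real) \<Rightarrow> ('a \<Rightarrow> 'e) \<Rightarrow> real" where
  "iter_upper \<gamma> [] f = f"
| "iter_upper \<gamma> (x # ws) f = iter_upper \<gamma> ws (sup_given (set ws) (site_avg \<gamma> x f))"

lemma iter_upper_nonneg:
  "\<lbrakk>\<And>\<omega>. 0 \<le> f \<omega>; \<And>\<omega>. f \<omega> \<le> 1\<rbrakk> \<Longrightarrow> 0 \<le> iter_upper \<gamma> ws f \<omega>"
proof (induction ws arbitrary: f)
  case (Cons x ws)
  show ?case
    unfolding iter_upper.simps by (intro Cons.IH sup_given_bounds site_avg_bounds Cons.prems)
qed simp

text \<open>The sites at which two maximally coupled configurations may differ: \<open>x\<close> can only differ if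
  it is open and the nearest past of \<open>x\<close> already contains a difference. Sites outside the list are
  regarded as always different.\<close>

fun disagreement :: "'a::order list \<Rightarrow> ('a \<Rightarrow> bool) \<Rightarrow> 'a set" where
  "disagreement [] X = {}"
| "disagreement (x # ws) X =
    (if X x \<and> (\<exists>y\<in>near_past_pt x. y \<notin> set ws \<or> y \<in> disagreement ws X)
     then insert x (disagreement ws X) else disagreement ws X)"

lemma depends_on_disagreement: "depends_on (set ws) (disagreement ws)"
proof (induction ws)
  case Nil
  then show ?case by (auto simp: depends_on_def)
next
  case (Cons x ws)
  show ?case
  proof (rule depends_onI)
    fix X X' :: "'a \<Rightarrow> bool" assume *: "\<And>u. u \<in> set (x # ws) \<Longrightarrow> X u = X' u"
    then have "disagreement ws X = disagreement ws X'"
      by (intro depends_onD[OF Cons.IH]) simp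
    with *[of x] show "disagreement (x # ws) X = disagreement (x # ws) X'"
      by (simp only: disagreement.simps list.set_intros)
  qed
qed

text \<open>The recursion inspects only the tail of the list. This loses nothing: with maximal sites
  first, no earlier site lies below \<open>x\<close>, so none belongs to its nearest past.\<close>

lemma disagreement_propagates:
  assumes "sorted_wrt (\<lambda>a b. \<not> a < b) ws" "x \<in> disagreement ws X"
  shows "x \<in> set ws \<and> X x \<and> (\<exists>y\<in>near_past_pt x. y \<notin> set ws \<or> y \<in> disagreement ws X)"
  using assms
proof (induction ws)
  case (Cons w ws)
  show ?case
  proof (cases "x \<in> disagreement ws X")
    case True
    with Cons have IH: "x \<in> set ws" "X x" "\<exists>y\<in>near_past_pt x. y \<notin> set ws \<or> y \<in> disagreement ws X"
      by auto
    then obtain y where y: "y \<in> near_past_pt x" "y \<notin> set ws \<or> y \<in> disagreement ws X" by blast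
    have "\<not> w < x" using Cons.prems(1) IH(1) by simp
    with y(1) have "y \<noteq> w" using near_past_pt_less by blast
    with IH y show ?thesis by auto
  next
    case False
    then have "x = w" and w: "X w" "\<exists>y\<in>near_past_pt w. y \<notin> set ws \<or> y \<in> disagreement ws X"
      using Cons.prems(2) by (auto split: if_splits)
    moreover have "y \<noteq> w" if "y \<in> near_past_pt w" for y
      using near_past_pt_less[OF that] by auto
    ultimately show ?thesis by auto
  qed
qed simp

text \<open>Levels need not be disjoint; the induction in
  \<open>disagreement_imp_long_open_path\<close> may use any level that contains the site.\<close>

fun past_level :: "'a::order set \<Rightarrow> nat \<Rightarrow> 'a set" where
  "past_level V 0 = V"
| "past_level V (Suc k) = (\<Union>x\<in>past_level V k. near_past_pt x)"

text \<open>A disagreement is traced back through nearest pasts until the trace leaves the list.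
  Starting from level \<open>k\<close>, it meets at least \<open>n - k\<close> open sites
  first.\<close>

lemma disagreement_imp_long_open_path:
  assumes ws: "sorted_wrt (\<lambda>a b. \<not> a < b) ws" "set ws = (\<Union>k<n. past_level V k)"
  shows "\<lbrakk>x \<in> disagreement ws X; x \<in> past_level V k; k + m = n\<rbrakk> \<Longrightarrow> long_open_path m X x"
proof (induction m arbitrary: x k)
  case (Suc m)
  from disagreement_propagates[OF ws(1) Suc.prems(1)] obtain y
    where y: "X x" "y \<in> near_past_pt x" "y \<notin> set ws \<or> y \<in> disagreement ws X" by blast
  have yk: "y \<in> past_level V (Suc k)" using y(2) Suc.prems(2) by auto
  \<comment> \<open>For \<open>m = 0\<close> the site \<open>y\<close> may lie outside
    \<open>ws\<close>, but nothing is demanded of it. Otherwise its level \<open>Suc k\<close> is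
    still below \<open>n\<close>.\<close>
  have "long_open_path m X y"
  proof (cases m)
    case (Suc l)
    then have "Suc k < n" using Suc.prems(3) by simp
    then have "y \<in> set ws" using yk ws(2) by blast
    with y(3) have "y \<in> disagreement ws X" by blast
    from Suc.IH[OF this yk] Suc.prems(3) show ?thesis by simp
  qed simp
  with y show ?case by auto
qed simp

section \<open>Upper bounds for consistent chains and their total excess over 1\<close>

context
  fixes \<gamma> :: "'a::order set \<Rightarrow> ('a \<Rightarrow> 'e::countable) \<Rightarrow> ('a \<Rightarrow> 'e) set \<Rightarrow> real"
  assumes pomm: "POMM \<gamma>"
begin

text \<open>Averaging over a site preserves the integral by consistency, and the supremum can only
  increase it. After the last site the function is constant, so any \<open>\<omega>0\<close> will
  do.\<close>

lemma consistent_chain_le_iter_upper: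
  assumes \<mu>: "\<mu> \<in> consistent_chains \<gamma>"
  shows "\<lbrakk>sorted_wrt (\<lambda>a b. \<not> a < b) ws; depends_on (set ws) f; \<And>\<omega>. 0 \<le> f \<omega>; \<And>\<omega>. f \<omega> \<le> 1\<rbrakk>
    \<Longrightarrow> (\<integral>\<^sup>+\<omega>. ennreal (f \<omega>) \<partial>\<mu>) \<le> ennreal (iter_upper \<gamma> ws f \<omega>0)"
proof (induction ws arbitrary: f)
  case Nil
  interpret prob_space \<mu> using \<mu> by (simp add: consistent_chains_def)
  have "f \<omega> = f \<omega>0" for \<omega> by (rule depends_onD[OF Nil.prems(2)]) simp
  then have "(\<integral>\<^sup>+\<omega>. ennreal (f \<omega>) \<partial>\<mu>) = (\<integral>\<^sup>+\<omega>. ennreal (f \<omega>0) \<partial>\<mu>)" by metis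
  then show ?case by (simp add: emeasure_space_1)
next
  case (Cons x ws)
  let ?g = "sup_given (set ws) (site_avg \<gamma> x f)"
  note avg = site_avg_bounds[of f \<gamma> x, OF Cons.prems(3,4)]
  have "(\<integral>\<^sup>+\<omega>. ennreal (f \<omega>) \<partial>\<mu>) = (\<integral>\<^sup>+\<omega>. ennreal (site_avg \<gamma> x f \<omega>) \<partial>\<mu>)"
    using Cons.prems
    by (intro consistent_chain_nn_integral_site_avg[OF pomm \<mu>, of "set (x # ws)"]) auto
  also have "\<dots> \<le> (\<integral>\<^sup>+\<omega>. ennreal (?g \<omega>) \<partial>\<mu>)"
    by (intro nn_integral_mono ennreal_leI sup_given_upper avg) auto
  also have "\<dots> \<le> ennreal (iter_upper \<gamma> ws ?g \<omega>0)"
    using Cons.prems(1)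
    by (intro Cons.IH depends_on_sup_given sup_given_bounds avg) auto
  finally show ?case by simp
qed

text \<open>\<open>h D\<close> bounds the excess of \<open>f \<eta> + g \<xi>\<close> over 1 when
  \<open>\<eta>\<close> and \<open>\<xi>\<close> differ, among the listed sites, exactly on
  \<open>D\<close>. Processing the head replaces \<open>h\<close> by its mean over the Bernoulli
  state of that site.\<close>

lemma iter_upper_add_le:
  "\<lbrakk>distinct ws; \<And>\<omega>. 0 \<le> f \<omega>; \<And>\<omega>. f \<omega> \<le> 1; \<And>\<omega>. 0 \<le> g \<omega>; \<And>\<omega>. g \<omega> \<le> 1;
      mono h; \<And>D. 0 \<le> h D; \<And>D. h D \<le> (1::real);
      \<And>\<eta> \<xi>. f \<eta> + g \<xi> \<le> 1 + h {y \<in> set ws. \<eta> y \<noteq> \<xi> y}\<rbrakk>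
    \<Longrightarrow> iter_upper \<gamma> ws f \<eta> + iter_upper \<gamma> ws g \<xi>
        \<le> 1 + (\<integral>X. h (disagreement ws X) \<partial>bernoulli_field (perc_param \<gamma>))"
proof (induction ws arbitrary: f g h)
  case Nil
  interpret prob_space "bernoulli_field (perc_param \<gamma>)" by (rule prob_space_bernoulli_field)
  show ?case using Nil.prems(9)[of \<eta> \<xi>] by (simp add: prob_space)
next
  case (Cons x ws)
  define p where "p = perc_param \<gamma> x"
  have p: "0 \<le> p" "p \<le> 1" unfolding p_def by (rule perc_param_bounds[OF pomm])+
  define hit where "hit D \<longleftrightarrow> (\<exists>y\<in>near_past_pt x. y \<notin> set ws \<or> y \<in> D)" for D
  \<comment> \<open>The mean of \<open>h\<close> once the state of \<open>x\<close> is drawn: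
    \<open>x\<close> is open with probability \<open>p\<close>, and an open \<open>x\<close> joins
    the disagreement only if it is hit.\<close>
  define h' where "h' D = (if hit D then p * h (insert x D) + (1 - p) * h D else h D)" for D
  note hmono = monoD[OF Cons.prems(6)]
  have x: "x \<notin> set ws" and "distinct ws" using Cons.prems(1) by auto
  have h'_ge: "h D \<le> h' D" for D
  proof -
    have "p * h D + (1 - p) * h D \<le> p * h (insert x D) + (1 - p) * h D"
      using p by (intro add_right_mono mult_left_mono hmono) auto
    then show ?thesis by (simp add: h'_def algebra_simps)
  qed
  have "mono h'"
  proof (rule monoI)
    fix D D' :: "'a set" assume "D \<subseteq> D'"
    show "h' D \<le> h' D'"
    proof (cases "hit D")
      case True
      then have "hit D'" using \<open>D \<subseteq> D'\<close> by (auto simp: hit_def)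
      moreover have "p * h (insert x D) + (1 - p) * h D \<le> p * h (insert x D') + (1 - p) * h D'"
        using p \<open>D \<subseteq> D'\<close> by (intro add_mono mult_left_mono hmono) auto
      ultimately show ?thesis using True by (simp add: h'_def)
    next
      case False
      then show ?thesis using h'_ge[of D'] hmono[OF \<open>D \<subseteq> D'\<close>] by (simp add: h'_def)
    qed
  qed
  have h'01: "0 \<le> h' D" "h' D \<le> 1" for D
    using p Cons.prems(7,8) by (auto simp: h'_def intro!: convex_bound_le)
  note avg = site_avg_bounds[of f \<gamma> x, OF Cons.prems(2,3)] site_avg_bounds[of g \<gamma> x, OF Cons.prems(4,5)]
  have step: "site_avg \<gamma> x f \<sigma> + site_avg \<gamma> x g \<tau> \<le> 1 + h' {y \<in> set ws. \<sigma> y \<noteq> \<tau> y}" for \<sigma> \<tau>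
  proof -
    define D where "D = {y \<in> set ws. \<sigma> y \<noteq> \<tau> y}"
    have off: "f (fun_upd \<sigma> x a) + g (fun_upd \<tau> x b) \<le> 1 + h (insert x D)" for a b
    proof -
      have "h {y \<in> set (x # ws). fun_upd \<sigma> x a y \<noteq> fun_upd \<tau> x b y} \<le> h (insert x D)"
        by (rule hmono) (auto simp: D_def)
      then show ?thesis using Cons.prems(9)[of "fun_upd \<sigma> x a" "fun_upd \<tau> x b"] by linarith
    qed
    have diag: "f (fun_upd \<sigma> x a) + g (fun_upd \<tau> x a) \<le> 1 + h D" for a
    proof -
      have "{y \<in> set (x # ws). fun_upd \<sigma> x a y \<noteq> fun_upd \<tau> x a y} = D"
        using x by (auto simp: D_def)
      then show ?thesis using Cons.prems(9)[of "fun_upd \<sigma> x a" "fun_upd \<tau> x a"] by (simp only:)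
    qed
    have couple: "site_avg \<gamma> x f \<sigma> + site_avg \<gamma> x g \<tau> \<le> 1 + q * h (insert x D) + (1 - q) * h D"
      if "(1/2) * (\<Sum>\<^sub>\<infinity>a. \<bar>pmf (site_pmf \<gamma> x \<sigma>) a - pmf (site_pmf \<gamma> x \<tau>) a\<bar>) \<le> q" for q
      unfolding site_avg_def
      by (rule pmf_integral_add_le_coupling[OF _ _ _ _ off diag _ that])
         (auto intro: Cons.prems hmono)
    show ?thesis
    proof (cases "hit D")
      case True
      with couple[OF half_infsum_site_pmf_le_perc_param[OF pomm]] show ?thesis
        by (simp add: h'_def D_def p_def)
    next
      \<comment> \<open>Without a hit, the nearest past of \<open>x\<close> lies in
        \<open>ws\<close> and carries the same colours in \<open>\<sigma>\<close> and
        \<open>\<tau>\<close>. The two laws at \<open>x\<close> coincide and the coupling bound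
        applies with \<open>q = 0\<close>.\<close>
      case False
      then have "site_pmf \<gamma> x \<sigma> = site_pmf \<gamma> x \<tau>"
        by (intro site_pmf_cong[OF pomm]) (auto simp: hit_def D_def)
      with couple[of 0] False show ?thesis by (simp add: h'_def D_def)
    qed
  qed
  have "sup_given (set ws) (site_avg \<gamma> x f) \<eta> + sup_given (set ws) (site_avg \<gamma> x g) \<xi>
      \<le> 1 + h' {y \<in> set ws. \<eta> y \<noteq> \<xi> y}" for \<eta> \<xi>
  proof -
    let ?c = "1 + h' {y \<in> set ws. \<eta> y \<noteq> \<xi> y}"
    have *: "site_avg \<gamma> x f \<sigma> + site_avg \<gamma> x g \<tau> \<le> ?c"
      if "\<And>y. y \<in> set ws \<Longrightarrow> \<sigma> y = \<eta> y" "\<And>y. y \<in> set ws \<Longrightarrow> \<tau> y = \<xi> y" for \<sigma> \<tau>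
    proof -
      have "{y \<in> set ws. \<sigma> y \<noteq> \<tau> y} = {y \<in> set ws. \<eta> y \<noteq> \<xi> y}" using that by auto
      then show ?thesis using step[of \<sigma> \<tau>] by simp
    qed
    \<comment> \<open>\<open>?c\<close> depends only on \<open>\<eta>\<close> and
      \<open>\<xi>\<close>, so the suprema over \<open>\<sigma>\<close> and \<open>\<tau>\<close>
      can be taken one after the other.\<close>
    have "sup_given (set ws) (site_avg \<gamma> x f) \<eta> \<le> ?c - site_avg \<gamma> x g \<tau>"
      if "\<And>y. y \<in> set ws \<Longrightarrow> \<tau> y = \<xi> y" for \<tau>
      by (rule sup_given_least) (use *[OF _ that] in \<open>simp add: le_diff_eq\<close>)
    then have "sup_given (set ws) (site_avg \<gamma> x g) \<xi> \<le> ?c - sup_given (set ws) (site_avg \<gamma> x f) \<eta>"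
      by (intro sup_given_least) (simp add: algebra_simps)
    then show ?thesis by simp
  qed
  then have "iter_upper \<gamma> ws (sup_given (set ws) (site_avg \<gamma> x f)) \<eta>
        + iter_upper \<gamma> ws (sup_given (set ws) (site_avg \<gamma> x g)) \<xi>
      \<le> 1 + (\<integral>X. h' (disagreement ws X) \<partial>bernoulli_field (perc_param \<gamma>))"
    by (intro Cons.IH sup_given_bounds avg \<open>mono h'\<close> h'01 \<open>distinct ws\<close>)
  \<comment> \<open>Integrating out the state of \<open>x\<close> turns \<open>h\<close> into
    \<open>h'\<close>, because \<open>disagreement ws\<close> does not look at
    \<open>x\<close>.\<close>
  also have "(\<integral>X. h' (disagreement ws X) \<partial>bernoulli_field (perc_param \<gamma>))
      = (\<integral>X. h (disagreement (x # ws) X) \<partial>bernoulli_field (perc_param \<gamma>))"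
  proof -
    have "depends_on (set (x # ws)) (\<lambda>X. h (disagreement (x # ws) X))"
      by (rule depends_onI, rule arg_cong[where f=h], rule depends_onD[OF depends_on_disagreement])
    from bernoulli_field_integral_resample[of "set (x # ws)" _ "perc_param \<gamma>" x, OF _ this] Cons.prems(7,8)
      p[unfolded p_def]
    have "(\<integral>X. h (disagreement (x # ws) X) \<partial>bernoulli_field (perc_param \<gamma>))
      = (\<integral>X. p * h (disagreement (x # ws) (fun_upd X x True))
           + (1 - p) * h (disagreement (x # ws) (fun_upd X x False)) \<partial>bernoulli_field (perc_param \<gamma>))"
      unfolding p_def by blast
    also have "\<dots> = (\<integral>X. h' (disagreement ws X) \<partial>bernoulli_field (perc_param \<gamma>))"
    proof (rule Bochner_Integration.integral_cong[OF refl])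
      fix X
      have "disagreement ws (fun_upd X x b) = disagreement ws X" for b
        by (rule depends_onD[OF depends_on_disagreement]) (use x in auto)
      then show "p * h (disagreement (x # ws) (fun_upd X x True))
           + (1 - p) * h (disagreement (x # ws) (fun_upd X x False)) = h' (disagreement ws X)"
        by (auto simp: h'_def hit_def algebra_simps)
    qed
    finally show ?thesis by simp
  qed
  finally show ?case by simp
qed

text \<open>The upper bounds for \<open>A\<close> under \<open>\<mu>\<close> and for
  \<open>- A\<close> under \<open>\<nu>\<close> add up to at most 1 plus a probability that vanishes
  as the depth grows. The roles of the chains can be exchanged, so one inequality suffices.\<close>

lemma consistent_chains_cylinder_le:
  assumes fin: "\<And>x::'a. finite (near_past_pt x)" and nonperc: "non_percolating (perc_param \<gamma>)"
    and \<mu>: "\<mu> \<in> consistent_chains \<gamma>" and \<nu>: "\<nu> \<in> consistent_chains \<gamma>"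
    and "finite V" and dep: "depends_on V (\<lambda>\<omega>. \<omega> \<in> A)"
  shows "measure \<mu> A \<le> measure \<nu> A"
proof -
  interpret \<mu>: prob_space \<mu> using \<mu> by (simp add: consistent_chains_def)
  interpret \<nu>: prob_space \<nu> using \<nu> by (simp add: consistent_chains_def)
  interpret \<psi>: prob_space "bernoulli_field (perc_param \<gamma>)" by (rule prob_space_bernoulli_field)
  have sets: "sets \<mu> = coord_sets UNIV" "sets \<nu> = coord_sets UNIV" "space \<nu> = UNIV"
    using \<mu> \<nu> by (auto simp: consistent_chains_def)
  have A: "A \<in> coord_sets UNIV"
    using depends_on_imp_coord_sets[OF \<open>finite V\<close> dep] coord_sets_mono[of V UNIV] by auto
  then have cA: "- A \<in> coord_sets UNIV"
    using sets.compl_sets[of A \<nu>] by (simp add: sets Compl_eq_Diff_UNIV)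
  define E where "E n = {X. \<exists>v\<in>V. long_open_path n X v}" for n
  have E: "E n \<in> sets (bernoulli_field (perc_param \<gamma>))" for n
  proof -
    have "E n = (\<Union>v\<in>V. {X. long_open_path n X v})" by (auto simp: E_def)
    then show ?thesis using \<open>finite V\<close> measurable_long_open_path[OF fin] by auto
  qed
  have lev: "finite (past_level V k)" for k
    by (induction k) (use \<open>finite V\<close> fin in auto)
  have bound: "measure \<mu> A \<le> measure \<nu> A + \<psi>.prob (E (Suc n))" for n
  proof -
    \<comment> \<open>Using \<open>Suc n\<close> levels ensures that level 0, which is
      \<open>V\<close>, is always included; the same number reappears in
      \<open>E (Suc n)\<close>.\<close>
    define W where "W = (\<Union>k<Suc n. past_level V k)"
    have "finite W" unfolding W_def using lev by auto
    then obtain ws where ws: "set ws = W" "distinct ws" "sorted_wrt (\<lambda>a b. \<not> a < b) ws"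
      using finite_list_maximal_first by blast
    have "V \<subseteq> W" unfolding W_def using UN_upper[of 0 "{..<Suc n}" "past_level V"] by simp
    \<comment> \<open>The sum of \<open>indicator A \<eta>\<close> and
      \<open>indicator (- A) \<xi>\<close> exceeds 1 only if \<open>\<eta>\<close> and
      \<open>\<xi>\<close> differ somewhere in \<open>V\<close>, so this \<open>h\<close> bounds the
      excess.\<close>
    define h :: "'a set \<Rightarrow> real" where "h D = (if D \<inter> V = {} then 0 else 1)" for D
    define \<omega>0 :: "'a \<Rightarrow> 'e" where "\<omega>0 = undefined"
    have depI: "depends_on (set ws) (indicator B :: _ \<Rightarrow> real)"
      if "depends_on V (\<lambda>\<omega>. \<omega> \<in> B)" for B :: "('a \<Rightarrow> 'e) set"
      proof (rule depends_onI)
      fix \<omega> \<omega>' :: "'a \<Rightarrow> 'e" assume "\<And>u. u \<in> set ws \<Longrightarrow> \<omega> u = \<omega>' u"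
      then have "\<omega> \<in> B \<longleftrightarrow> \<omega>' \<in> B"
        using \<open>V \<subseteq> W\<close> ws(1) by (intro depends_onD[OF that]) auto
      then show "indicator B \<omega> = (indicator B \<omega>' :: real)" by (simp add: indicator_def)
    qed
    have dep': "depends_on V (\<lambda>\<omega>. \<omega> \<in> - A)" using dep by (auto simp: depends_on_def)
    have "(\<integral>\<^sup>+\<omega>. ennreal (indicator A \<omega>) \<partial>\<mu>) \<le> ennreal (iter_upper \<gamma> ws (indicator A) \<omega>0)"
      by (rule consistent_chain_le_iter_upper[OF \<mu> ws(3) depI[OF dep]]) auto
    then have 1: "ennreal (measure \<mu> A) \<le> ennreal (iter_upper \<gamma> ws (indicator A) \<omega>0)"
      using A by (simp add: sets ennreal_indicator \<mu>.emeasure_eq_measure)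
    have "(\<integral>\<^sup>+\<omega>. ennreal (indicator (- A) \<omega>) \<partial>\<nu>) \<le> ennreal (iter_upper \<gamma> ws (indicator (- A)) \<omega>0)"
      by (rule consistent_chain_le_iter_upper[OF \<nu> ws(3) depI[OF dep']]) auto
    then have 2: "ennreal (measure \<nu> (- A)) \<le> ennreal (iter_upper \<gamma> ws (indicator (- A)) \<omega>0)"
      using cA by (simp add: sets ennreal_indicator \<nu>.emeasure_eq_measure)
    have "iter_upper \<gamma> ws (indicator A) \<omega>0 + iter_upper \<gamma> ws (indicator (- A)) \<omega>0
        \<le> 1 + (\<integral>X. h (disagreement ws X) \<partial>bernoulli_field (perc_param \<gamma>))"
    proof (rule iter_upper_add_le[OF ws(2)])
      show "mono h" by (rule monoI) (auto simp: h_def)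
      fix \<eta> \<xi> :: "'a \<Rightarrow> 'e"
      show "indicator A \<eta> + indicator (- A) \<xi> \<le> 1 + h {y \<in> set ws. \<eta> y \<noteq> \<xi> y}"
      proof (cases "\<forall>v\<in>V. \<eta> v = \<xi> v")
        case True
        then have "\<eta> \<in> A \<longleftrightarrow> \<xi> \<in> A" by (intro depends_onD[OF dep]) auto
        then show ?thesis by (auto simp: h_def indicator_def)
      next
        case False
        then have "h {y \<in> set ws. \<eta> y \<noteq> \<xi> y} = 1"
          using \<open>V \<subseteq> W\<close> ws(1) by (auto simp: h_def)
        then show ?thesis by (auto simp: indicator_def)
      qed
    qed (auto simp: h_def)
    also have "(\<integral>X. h (disagreement ws X) \<partial>bernoulli_field (perc_param \<gamma>))
        \<le> (\<integral>X. indicator (E (Suc n)) X \<partial>bernoulli_field (perc_param \<gamma>))"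
    proof (rule integral_mono)
      have "depends_on (set ws) (\<lambda>X. h (disagreement ws X))"
        by (rule depends_onI, rule arg_cong[where f=h], rule depends_onD[OF depends_on_disagreement])
      then have "(\<lambda>X. h (disagreement ws X)) \<in> borel_measurable (bernoulli_field (perc_param \<gamma>))"
        by (intro depends_on_imp_measurable[OF _ _ _ sets_bernoulli_field]) auto
      then show "integrable (bernoulli_field (perc_param \<gamma>)) (\<lambda>X. h (disagreement ws X))"
        by (intro \<psi>.integrable_const_bound[where B=1]) (auto simp: h_def)
      show "integrable (bernoulli_field (perc_param \<gamma>)) (indicator (E (Suc n)) :: _ \<Rightarrow> real)"
        using E by (auto simp: \<psi>.emeasure_eq_measure)
      fix X :: "'a \<Rightarrow> bool"
      show "h (disagreement ws X) \<le> indicator (E (Suc n)) X"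
      proof (cases "disagreement ws X \<inter> V = {}")
        case False
        then obtain v where "v \<in> disagreement ws X" "v \<in> V" by blast
        then have "long_open_path (Suc n) X v"
          by (intro disagreement_imp_long_open_path[OF ws(3) ws(1)[unfolded W_def], of _ _ 0]) auto
        then have "X \<in> E (Suc n)" using \<open>v \<in> V\<close> by (auto simp: E_def)
        then show ?thesis by (auto simp: h_def)
      qed (simp add: h_def)
    qed
    also have "\<dots> = \<psi>.prob (E (Suc n))" using E by simp
    finally have "iter_upper \<gamma> ws (indicator A) \<omega>0 + iter_upper \<gamma> ws (indicator (- A)) \<omega>0
        \<le> 1 + \<psi>.prob (E (Suc n))" by simp
    moreover have "measure \<nu> (- A) = 1 - measure \<nu> A"
      using \<nu>.prob_compl[of A] A by (simp add: sets Compl_eq_Diff_UNIV)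
    moreover have "measure \<mu> A \<le> iter_upper \<gamma> ws (indicator A) \<omega>0"
      using 1 by (subst (asm) ennreal_le_iff) (auto intro: iter_upper_nonneg)
    moreover have "measure \<nu> (- A) \<le> iter_upper \<gamma> ws (indicator (- A)) \<omega>0"
      using 2 by (subst (asm) ennreal_le_iff) (auto intro: iter_upper_nonneg)
    ultimately show ?thesis by linarith
  qed
  have "(\<lambda>n. \<psi>.prob (E n)) \<longlonglongrightarrow> 0"
    unfolding E_def by (rule long_open_path_prob_tendsto_0[OF fin nonperc \<open>finite V\<close>])
  then have "(\<lambda>n. measure \<nu> A + \<psi>.prob (E (Suc n))) \<longlonglongrightarrow> measure \<nu> A + 0"
    by (intro tendsto_add tendsto_const LIMSEQ_Suc)
  from LIMSEQ_le_const[OF this] bound show ?thesis by auto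
qed

end

section \<open>From finite cylinders to all events\<close>

theorem mainTheorem14:
  fixes \<gamma> :: "'a::{order,countable} set \<Rightarrow> ('a \<Rightarrow> 'e::countable) \<Rightarrow> ('a \<Rightarrow> 'e) set \<Rightarrow> real"
  assumes max_fin: "\<forall>x::'a. finite (pos_max {y. y < x})"
    and min_fin: "\<forall>x::'a. finite (pos_min {z. x < z})"
    and below_max: "\<forall>x y::'a. y < x \<longrightarrow> (\<exists>y0\<in>pos_max {y. y < x}. y \<le> y0)"
    and above_min: "\<forall>x z::'a. x < z \<longrightarrow> (\<exists>z0\<in>pos_min {z. x < z}. z0 \<le> z)"
    and no_min: "\<forall>x::'a. \<exists>y. y < x"
    and pomm: "POMM \<gamma>"
    and nonperc: "non_percolating (perc_param \<gamma>)"
  shows "\<forall>\<mu>\<in>consistent_chains \<gamma>. \<forall>\<nu>\<in>consistent_chains \<gamma>. \<mu> = \<nu>"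
proof (intro ballI)
  fix \<mu> \<nu> assume \<mu>: "\<mu> \<in> consistent_chains \<gamma>" and \<nu>: "\<nu> \<in> consistent_chains \<gamma>"
  interpret \<mu>: prob_space \<mu> using \<mu> by (simp add: consistent_chains_def)
  interpret \<nu>: prob_space \<nu> using \<nu> by (simp add: consistent_chains_def)
  \<comment> \<open>The events decided by finitely many sites are stable under intersection and
    generate the sigma-algebra, so agreement of the two probability measures on them
    suffices.\<close>
  define \<C> where "\<C> = {A :: ('a \<Rightarrow> 'e) set. \<exists>V. finite V \<and> depends_on V (\<lambda>\<omega>. \<omega> \<in> A)}"
  have fin: "finite (near_past_pt x)" for x :: 'a
    using max_fin by (simp add: near_past_pt_def)
  have gen: "coord_sets UNIV = sigma_sets UNIV \<C>"
  proof (rule antisym)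
    show "coord_sets UNIV \<subseteq> sigma_sets UNIV \<C>"
      unfolding coord_sets_def
    proof (rule sigma_sets_mono')
      show "{{\<omega>. \<omega> x \<in> B} |x B. x \<in> UNIV} \<subseteq> \<C>"
      proof clarify
        fix x :: 'a and B :: "'e set"
        show "{\<omega>. \<omega> x \<in> B} \<in> \<C>"
          unfolding \<C>_def by (intro CollectI exI[of _ "{x}"]) (auto simp: depends_on_def)
      qed
    qed
    have "\<C> \<subseteq> coord_sets UNIV"
    proof
      fix A assume "A \<in> \<C>"
      then obtain V where "A \<in> coord_sets V"
        unfolding \<C>_def using depends_on_imp_coord_sets by blast
      then show "A \<in> coord_sets UNIV" using coord_sets_mono[of V UNIV] by auto
    qed
    then show "sigma_sets UNIV \<C> \<subseteq> coord_sets UNIV"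
      using sigma_algebra.sigma_sets_subset[OF sigma_algebra_coord_sets] by blast
  qed
  show "\<mu> = \<nu>"
  proof (rule measure_eqI_generator_eq[where E=\<C> and \<Omega>=UNIV and A="\<lambda>_. UNIV"])
    show "Int_stable \<C>"
    proof (rule Int_stableI)
      fix A B assume "A \<in> \<C>" "B \<in> \<C>"
      then obtain U V where "finite U" "depends_on U (\<lambda>\<omega>. \<omega> \<in> A)" "finite V" "depends_on V (\<lambda>\<omega>. \<omega> \<in> B)"
        by (auto simp: \<C>_def)
      moreover from this have "depends_on (U \<union> V) (\<lambda>\<omega>. \<omega> \<in> A \<inter> B)"
        unfolding depends_on_def by (simp add: ball_Un) blast
      ultimately show "A \<inter> B \<in> \<C>"
        unfolding \<C>_def by blast
    qed
    fix A assume "A \<in> \<C>"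
    then obtain V where V: "finite V" "depends_on V (\<lambda>\<omega>. \<omega> \<in> A)" by (auto simp: \<C>_def)
    have "measure \<mu> A = measure \<nu> A"
      using consistent_chains_cylinder_le[OF pomm fin nonperc \<mu> \<nu> V]
        consistent_chains_cylinder_le[OF pomm fin nonperc \<nu> \<mu> V] by simp
    then show "emeasure \<mu> A = emeasure \<nu> A"
      by (simp add: \<mu>.emeasure_eq_measure \<nu>.emeasure_eq_measure)
  qed (use \<mu> \<nu> gen in \<open>auto simp: consistent_chains_def \<C>_def depends_on_def\<close>)
qed

end
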